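(* Consider the output-feedback minimax adaptive control problem (see context) with a finite model set $\mathcal M$, its elements indexed $1,\dots,|\mathcal M|$, under the rank assumptions and the fixed-point assumption stated in the context for each $M\in\mathcal M$. For each $M=(A_M,B_M,G_M,C_M,D_M)\in\mathcal M$ let $(S_M,X_M,L_M)$ be its Riccati fixed point, $\hat A_M=A_MX_M^{-1}S_M$, $\hat B_M=B_M$, $\hat G_M=L_M$, and let $\hat Q_M$ be the symmetric matrix with blocks indexed by $x,u,y$: $$\hat Q_M^{xx}=S_MX_M^{-1}S_M-S_M,\quad \hat Q_M^{xu}=0,\quad \hat Q_M^{uu}=R,\quad \hat Q_M^{uy}=0,$$ $$\hat Q_M^{xy}=\gamma^2S_MX_M^{-1}C_M^{\mathsf T}(D_MD_M^{\mathsf T})^{-1},\quad \hat Q_M^{yy}=-\bigl(D_MD_M^{\mathsf T}/\gamma^2+C_M(S_M-Q)^{-1}C_M^{\mathsf T}\bigr)^{-1}.$$ Let $\hat A=\mathrm{BlockDiag}\{\hat A_M:M\in\mathcal M\}$, let $\hat B$ and $\hat G$ be obtained by stacking the $\hat B_M$ and $\hat G_M$ vertically, let $z_t$ be the vertical stack of the observer states $\hat x_{1,t},\dots,\hat x_{|\mathcal M|,t}$, where $\hat x_{M,t+1}=\hat A_M\hat x_{M,t}+\hat B_Mu_t+\hat G_My_t$ and $\hat x_{M,0}=\hat x_0$, and let $d_t=y_t$. For $i=1,\dots,|\mathcal M|$ let $H_i\in\mathbb S^{|\mathcal M|n_x+n_u+n_y}$ be the symmetric matrix with $\sigma_{H_i}(z,u,y)=\sigma_{\hat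 Q_i}(\hat x_i,u,y)$ for all $z=(\hat x_1,\dots,\hat x_{|\mathcal M|})$, $u$, $y$ (i.e. the blocks of $\hat Q_i$ are placed in the $i$-th $x$-block row/column and the $u$, $y$ rows/columns, all other entries being zero). Then the optimal value of the output-feedback problem equals the optimal value of the principal problem (see context) with model set $\widehat{\mathcal M}=\{H_M:M\in\mathcal M\}$, these $\hat A,\hat B,\hat G$ and this $z_0$. Further, given a policy $\hat\mu:(z_0,\dots,z_t,u_0,\dots,u_{t-1},y_0,\dots,y_{t-1})\mapsto u_t$ for the principal problem, $$\sup_{d,N,H\in\widehat{\mathcal M}}\hat J^N_{\hat\mu}(z_0,H,d)=\sup_{y,M\in\mathcal M,N,w,v,x_0}J^N_\mu(\hat x_0,M,y,w,v,x_0),$$ where the policy $$\mu(y_0,\dots,y_{t-1},u_0,\dots,u_{t-1})=\hat\mu(z_0,\dots,z_t,u_0,\dots,u_{t-1},y_0,\dots,y_{t-1})$$ is feasible for the output-feedback problem.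
   Context: Notation: $\mathbb S^n$ is the space of real symmetric $n\times n$ matrices; $|x|_P^2=x^{\mathsf T}Px$; for a symmetric block matrix $H$, $\sigma_H(x_1,\dots,x_m)=\sum_{i,j}x_i^{\mathsf T}H^{ij}x_j$. For $H$ with blocks indexed by $z,u,d$ and $H^{dd}$ invertible, $H/H^{dd}$ is the Schur complement, with $(a,b)$ block $H^{ab}-H^{ad}(H^{dd})^{-1}H^{db}$, $a,b\in\{z,u\}$. Output-feedback problem. $Q\in\mathbb S^{n_x}$, $R\in\mathbb S^{n_u}$ positive definite, $\gamma>0$, $\hat x_0\in\mathbb R^{n_x}$, and a set $\mathcal M$ of models $M=(A,B,G,C,D)\in \mathbb R^{n_x\times n_x}\times\mathbb R^{n_x\times n_u}\times\mathbb R^{n_x\times n_w}\times\mathbb R^{n_y\times n_x}\times\mathbb R^{n_y\times n_v}$ with weights $S_{M,0}\succeq0$. Trajectories: $x_{t+1}=Ax_t+Bu_t+Gw_t$, $y_t=Cx_t+Dv_t$, $u_t=\mu_t(y_0,\dots,y_{t-1},u_0,\dots,u_{t-1})$. Cost: $$J^N_\mu(\hat x_0,M,y,w,v,x_0)=-|x_0-\hat x_0|^2_{S_{M,0}}+\sum_{t=0}^{N-1}\bigl(|x_t|_Q^2+|u_t|_R^2-\gamma^2|(w_t,v_t)|^2\bigr).$$ Value: $\inf_\mu\sup_{y,M\in\mathcal M,N\ge0,w,v,x_0}J^N_\mu$, the supremum being over $(y,w,v,x_0)$ consistent with the trajectory equations above under the model $M$. Rank assumptions (for each $M$): $[A\ \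 G]$ and $D$ have full row rank, and $[A^{\mathsf T}\ \sqrt Q]^{\mathsf T}$ has full column rank. Riccati recursions (for each $M$): $S_{t+1}=(AX_t^{-1}A^{\mathsf T}+\gamma^{-2}GG^{\mathsf T})^{-1}$, $X_t=S_t+\gamma^2C^{\mathsf T}(DD^{\mathsf T})^{-1}C-Q$, $L_t=\gamma^2AX_t^{-1}C^{\mathsf T}(DD^{\mathsf T})^{-1}$. A triple $(S,X,L)$ is a fixed point if the relations hold with $S_t=S_{t+1}=S$, $X_t=X$, $L_t=L$; it is stabilizing if it makes the observer dynamics stable, i.e. $AX^{-1}S$ is Schur stable. Fixed-point assumption (for each $M$): $\gamma$ is large enough that there exists a stabilizing positive definite fixed point of the Riccati recursions; $S_M$ denotes the minimal fixed point, and $S_{M,0}=S_M$. Principal problem. Data: $\hat A\in\mathbb R^{n_z\times n_z}$, $\hat B\in\mathbb R^{n_z\times n_u}$, $\hat G\in\mathbb R^{n_z\times n_d}$, $z_0$, and a compact model set $\widehat{\mathcal M}\subset\mathbb S^{n_z+n_u+n_d}$ whose members satisfy $H^{dd}\prec0$, $H/H^{dd}\succeq0$, $[H/H^{dd}]^{uu}\succ0$. Dynamics and policy: $z_{t+1}=\hat Az_t+\hat Bu_t+\hat Gd_t$, $u_t=\hat\mu_t(z_0,\dots,z_t,u_0,\dots,u_{t-1},d_0,\dots,d_{t-1})$. Cost: $\hat J^N_{\hat\mu}(z_0,H,d)=\sum_{t=0}^{N-1}\sigma_H(z_t,u_t,d_t)$. Value: $\inf_{\hat\mu}\sup_{H\in\widehat{\mathcal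 M},d,N\ge0}\hat J^N_{\hat\mu}(z_0,H,d)$.
   Formalization: It is assumed that S_M − Q is invertible, and a positive definite fixed point means both S and X are positive definite; that the H_M satisfy the principal problem's conditions (such as H^dd ≺ 0) is claimed only when every S_M − Q is positive definite, as it fails otherwise. *)

theory Defs
  imports "HOL-Analysis.Analysis"
begin

section \<open>Matrices\<close>

definition pos_def :: "real^'n^'n \<Rightarrow> bool" where
  "pos_def P \<longleftrightarrow> transpose P = P \<and> (\<forall>x. x \<noteq> 0 \<longrightarrow> 0 < x \<bullet> (P *v x))"

definition pos_semidef :: "real^'n^'n \<Rightarrow> bool" where
  "pos_semidef P \<longleftrightarrow> transpose P = P \<and> (\<forall>x. 0 \<le> x \<bullet> (P *v x))"

definition neg_def :: "real^'n^'n \<Rightarrow> bool" where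
  "neg_def P \<longleftrightarrow> pos_def (- P)"

definition wnorm2 :: "real^'n^'n \<Rightarrow> real^'n \<Rightarrow> real" where
  "wnorm2 P x = x \<bullet> (P *v x)"

definition psd_sqrt :: "real^'n^'n \<Rightarrow> real^'n^'n" where
  "psd_sqrt Q = (THE T. pos_semidef T \<and> T ** T = Q)"

definition schur_stable :: "real^'n^'n \<Rightarrow> bool" where
  "schur_stable A \<longleftrightarrow>
     (\<forall>(c::complex) v. v \<noteq> 0 \<and> map_matrix complex_of_real A *v v = c *s v \<longrightarrow> cmod c < 1)"

definition hcat :: "real^'a::finite^'n \<Rightarrow> real^'b::finite^'n \<Rightarrow> real^('a + 'b)^'n" where
  "hcat P T = (\<chi> i j. case j of Inl k \<Rightarrow> P $ i $ k | Inr k \<Rightarrow> T $ i $ k)"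

definition vcat :: "real^'n^'a::finite \<Rightarrow> real^'n^'b::finite \<Rightarrow> real^'n^('a + 'b)" where
  "vcat P T = (\<chi> i. case i of Inl k \<Rightarrow> P $ k | Inr k \<Rightarrow> T $ k)"

definition submatrix :: "('a \<Rightarrow> 'm) \<Rightarrow> ('b \<Rightarrow> 'n) \<Rightarrow> real^'n^'m \<Rightarrow> real^'b^'a" where
  "submatrix f g H = (\<chi> i j. H $ f i $ g j)"

text \<open>Block matrices with three block rows and columns are indexed by the sum type
  \<open>'z + 'u + 'd\<close>, that is, \<open>'z + ('u + 'd)\<close>; the following are the embeddings of the
  three index ranges.\<close>

definition ixz :: "'z \<Rightarrow> 'z + 'u + 'd" where "ixz = Inl"
definition ixu :: "'u \<Rightarrow> 'z + 'u + 'd" where "ixu = Inr \<circ> Inl"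
definition ixd :: "'d \<Rightarrow> 'z + 'u + 'd" where "ixd = Inr \<circ> Inr"

definition sigma3 :: "real^('z::finite + 'u::finite + 'd::finite)^('z + 'u + 'd) \<Rightarrow> real^'z \<Rightarrow> real^'u \<Rightarrow> real^'d \<Rightarrow> real" where
  "sigma3 H z u d =
      z \<bullet> (submatrix ixz ixz H *v z) + z \<bullet> (submatrix ixz ixu H *v u) + z \<bullet> (submatrix ixz ixd H *v d)
    + u \<bullet> (submatrix ixu ixz H *v z) + u \<bullet> (submatrix ixu ixu H *v u) + u \<bullet> (submatrix ixu ixd H *v d)
    + d \<bullet> (submatrix ixd ixz H *v z) + d \<bullet> (submatrix ixd ixu H *v u) + d \<bullet> (submatrix ixd ixd H *v d)"

text \<open>The matrix given by its upper triangular blocks, the lower ones being their transposes.\<close>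

definition sym_block3 ::
  "real^'z^'z::finite \<Rightarrow> real^'u^'z \<Rightarrow> real^'d^'z \<Rightarrow> real^'u^'u::finite \<Rightarrow> real^'d^'u \<Rightarrow> real^'d^'d::finite
     \<Rightarrow> real^('z + 'u + 'd)^('z + 'u + 'd)" where
  "sym_block3 Hzz Hzu Hzd Huu Hud Hdd =
     vcat (hcat Hzz (hcat Hzu Hzd))
       (vcat (hcat (transpose Hzu) (hcat Huu Hud))
             (hcat (transpose Hzd) (hcat (transpose Hud) Hdd)))"

text \<open>\<open>H / H\<^sup>d\<^sup>d\<close>, indexed by \<open>'z + 'u\<close>.\<close>

definition schur_dd :: "real^('z::finite + 'u::finite + 'd::finite)^('z + 'u + 'd) \<Rightarrow> real^('z + 'u)^('z + 'u)" where
  "schur_dd H = (let zu = case_sum ixz ixu in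
     submatrix zu zu H
       - submatrix zu ixd H ** matrix_inv (submatrix ixd ixd H) ** submatrix ixd zu H)"

text \<open>Vectors and matrices consisting of one block of size \<open>'n\<close> for each \<open>i :: 'm\<close>.\<close>

definition stack_vec :: "('m \<Rightarrow> real^'n) \<Rightarrow> real^('m::finite \<times> 'n::finite)" where
  "stack_vec f = (\<chi> p. f (fst p) $ snd p)"

definition stack_mat :: "('m \<Rightarrow> real^'k^'n) \<Rightarrow> real^'k^('m::finite \<times> 'n::finite)" where
  "stack_mat F = (\<chi> p. F (fst p) $ snd p)"

definition block_diag :: "('m \<Rightarrow> real^'n^'n) \<Rightarrow> real^('m::finite \<times> 'n::finite)^('m \<times> 'n)" where
  "block_diag F = (\<chi> p q. if fst p = fst q then F (fst p) $ snd p $ snd q else 0)"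

text \<open>\<open>place i P\<close> puts the blocks of \<open>P\<close> into the \<open>i\<close>-th x-block row and column and the u and y
  rows and columns of a larger matrix; \<open>place_ix i\<close> maps an index of the large matrix
  to the corresponding index of \<open>P\<close>, if there is one.\<close>

fun place_ix :: "'m \<Rightarrow> ('m \<times> 'x) + 'r \<Rightarrow> ('x + 'r) option" where
  "place_ix i (Inl p) = (if fst p = i then Some (Inl (snd p)) else None)"
| "place_ix i (Inr r) = Some (Inr r)"

definition place :: "'m::finite \<Rightarrow> real^('x::finite + 'u::finite + 'y::finite)^('x + 'u + 'y)
    \<Rightarrow> real^(('m \<times> 'x) + 'u + 'y)^(('m \<times> 'x) + 'u + 'y)" where
  "place i P = (\<chi> a b. case (place_ix i a, place_ix i b) of
      (Some a', Some b') \<Rightarrow> P $ a' $ b' | _ \<Rightarrow> 0)"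

lemma sigma3_place:
  fixes f :: "'m::finite \<Rightarrow> real^'x::finite"
  shows "sigma3 (place i P) (stack_vec f) u y = sigma3 P (f i) u y"
proof -
  have s: "(\<Sum>p\<in>UNIV. (h::'m \<times> 'x \<Rightarrow> real) p) = (\<Sum>k\<in>UNIV. h (i, k))"
    if h0: "\<And>p. fst p \<noteq> i \<Longrightarrow> h p = 0" for h
  proof -
    have "(\<Sum>p\<in>UNIV. h p) = sum h ({i} \<times> UNIV)"
      using h0 by (intro sum.mono_neutral_right) (auto, metis fst_conv)
    also have "\<dots> = (\<Sum>k\<in>UNIV. h (i, k))"
      by (simp add: sum.cartesian_product')
    finally show ?thesis .
  qed
  show ?thesis
    unfolding sigma3_def inner_vec_def matrix_vector_mult_def
    by (simp add: s submatrix_def place_def ixz_def ixu_def ixd_def stack_vec_def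
        cong: if_cong)
qed


section \<open>The output-feedback problem\<close>

datatype ('x::finite, 'u::finite, 'w::finite, 'y::finite, 'v::finite) model =
  Model (mA: "real^'x^'x") (mB: "real^'u^'x") (mG: "real^'w^'x") (mC: "real^'x^'y") (mD: "real^'v^'y")

text \<open>A policy maps the lists \<open>[y\<^sub>0, \<dots>, y\<^sub>t\<^sub>-\<^sub>1]\<close> and \<open>[u\<^sub>0, \<dots>, u\<^sub>t\<^sub>-\<^sub>1]\<close> to \<open>u\<^sub>t\<close>, so that
  \<open>\<mu>\<^sub>t\<close> is its restriction to lists of length \<open>t\<close>.\<close>

type_synonym ('y, 'u) of_policy = "(real^'y) list \<Rightarrow> (real^'u) list \<Rightarrow> real^'u"

fun of_input :: "('y::finite, 'u::finite) of_policy \<Rightarrow> (nat \<Rightarrow> real^'y) \<Rightarrow> nat \<Rightarrow> real^'u" where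
  "of_input \<mu> y t = \<mu> (map y [0..<t]) (map (of_input \<mu> y) [0..<t])"

declare of_input.simps [simp del]

primrec of_state :: "('x::finite, 'u::finite, 'w::finite, 'y::finite, 'v::finite) model
    \<Rightarrow> real^'x \<Rightarrow> (nat \<Rightarrow> real^'u) \<Rightarrow> (nat \<Rightarrow> real^'w) \<Rightarrow> nat \<Rightarrow> real^'x" where
  "of_state M x0 u w 0 = x0"
| "of_state M x0 u w (Suc t) = mA M *v of_state M x0 u w t + mB M *v u t + mG M *v w t"

definition of_consistent :: "('y::finite, 'u::finite) of_policy
    \<Rightarrow> ('x::finite, 'u, 'w::finite, 'y, 'v::finite) model
    \<Rightarrow> (nat \<Rightarrow> real^'y) \<Rightarrow> (nat \<Rightarrow> real^'w) \<Rightarrow> (nat \<Rightarrow> real^'v) \<Rightarrow> real^'x \<Rightarrow> bool" where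
  "of_consistent \<mu> M y w v x0 \<longleftrightarrow>
     (\<forall>t. y t = mC M *v of_state M x0 (of_input \<mu> y) w t + mD M *v v t)"

definition of_cost :: "real^'x^'x \<Rightarrow> real^'u^'u \<Rightarrow> real
    \<Rightarrow> (('x::finite, 'u::finite, 'w::finite, 'y::finite, 'v::finite) model \<Rightarrow> real^'x^'x)
    \<Rightarrow> real^'x \<Rightarrow> nat \<Rightarrow> ('y, 'u) of_policy \<Rightarrow> ('x, 'u, 'w, 'y, 'v) model
    \<Rightarrow> (nat \<Rightarrow> real^'y) \<Rightarrow> (nat \<Rightarrow> real^'w) \<Rightarrow> (nat \<Rightarrow> real^'v) \<Rightarrow> real^'x \<Rightarrow> real" where
  "of_cost Q R \<gamma> S0 xhat0 N \<mu> M y w v x0 =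
     - wnorm2 (S0 M) (x0 - xhat0)
     + (\<Sum>t<N. wnorm2 Q (of_state M x0 (of_input \<mu> y) w t) + wnorm2 R (of_input \<mu> y t)
               - \<gamma>\<^sup>2 * (norm (w t, v t))\<^sup>2)"

definition of_sup :: "real^'x^'x \<Rightarrow> real^'u^'u \<Rightarrow> real
    \<Rightarrow> ('x::finite, 'u::finite, 'w::finite, 'y::finite, 'v::finite) model set
    \<Rightarrow> (('x, 'u, 'w, 'y, 'v) model \<Rightarrow> real^'x^'x)
    \<Rightarrow> real^'x \<Rightarrow> ('y, 'u) of_policy \<Rightarrow> ereal" where
  "of_sup Q R \<gamma> \<M> S0 xhat0 \<mu> =
     (SUP (y, M, N, w, v, x0) \<in> {(y, M, N, w, v, x0). M \<in> \<M> \<and> of_consistent \<mu> M y w v x0}.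
        ereal (of_cost Q R \<gamma> S0 xhat0 N \<mu> M y w v x0))"

definition of_value :: "real^'x^'x \<Rightarrow> real^'u^'u \<Rightarrow> real
    \<Rightarrow> ('x::finite, 'u::finite, 'w::finite, 'y::finite, 'v::finite) model set
    \<Rightarrow> (('x, 'u, 'w, 'y, 'v) model \<Rightarrow> real^'x^'x) \<Rightarrow> real^'x \<Rightarrow> ereal" where
  "of_value Q R \<gamma> \<M> S0 xhat0 = (INF \<mu>. of_sup Q R \<gamma> \<M> S0 xhat0 \<mu>)"


section \<open>Rank assumptions and Riccati recursions\<close>

definition rank_assumptions :: "real^'x^'x
    \<Rightarrow> ('x::finite, 'u::finite, 'w::finite, 'y::finite, 'v::finite) model \<Rightarrow> bool" where
  "rank_assumptions Q (M :: ('x, 'u, 'w, 'y, 'v) model) \<longleftrightarrow>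
     rank (hcat (mA M) (mG M)) = CARD('x) \<and>
     rank (mD M) = CARD('y) \<and>
     rank (vcat (mA M) (psd_sqrt Q)) = CARD('x)"

definition ric_W :: "('x::finite, 'u::finite, 'w::finite, 'y::finite, 'v::finite) model \<Rightarrow> real^'y^'y" where
  "ric_W M = mD M ** transpose (mD M)"

definition ric_S :: "real \<Rightarrow> ('x::finite, 'u::finite, 'w::finite, 'y::finite, 'v::finite) model
    \<Rightarrow> real^'x^'x \<Rightarrow> real^'x^'x" where
  "ric_S \<gamma> M X = matrix_inv (mA M ** matrix_inv X ** transpose (mA M)
                             + (1 / \<gamma>\<^sup>2) *\<^sub>R (mG M ** transpose (mG M)))"

definition ric_X :: "real^'x^'x \<Rightarrow> real
    \<Rightarrow> ('x::finite, 'u::finite, 'w::finite, 'y::finite, 'v::finite) model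
    \<Rightarrow> real^'x^'x \<Rightarrow> real^'x^'x" where
  "ric_X Q \<gamma> M S = S + \<gamma>\<^sup>2 *\<^sub>R (transpose (mC M) ** matrix_inv (ric_W M) ** mC M) - Q"

definition ric_L :: "real \<Rightarrow> ('x::finite, 'u::finite, 'w::finite, 'y::finite, 'v::finite) model
    \<Rightarrow> real^'x^'x \<Rightarrow> real^'y^'x" where
  "ric_L \<gamma> M X = \<gamma>\<^sup>2 *\<^sub>R (mA M ** matrix_inv X ** transpose (mC M) ** matrix_inv (ric_W M))"

text \<open>Positive definiteness is required of both \<open>S\<close> and \<open>X\<close>.  Together with the rank assumptions
  it makes every inverse in the recursions a genuine one.\<close>

definition pd_fixed_point :: "real^'x^'x \<Rightarrow> real
    \<Rightarrow> ('x::finite, 'u::finite, 'w::finite, 'y::finite, 'v::finite) model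
    \<Rightarrow> real^'x^'x \<Rightarrow> real^'x^'x \<Rightarrow> real^'y^'x \<Rightarrow> bool" where
  "pd_fixed_point Q \<gamma> M S X L \<longleftrightarrow>
     S = ric_S \<gamma> M X \<and> X = ric_X Q \<gamma> M S \<and> L = ric_L \<gamma> M X \<and> pos_def S \<and> pos_def X"

definition stabilizing :: "('x::finite, 'u::finite, 'w::finite, 'y::finite, 'v::finite) model
    \<Rightarrow> real^'x^'x \<Rightarrow> real^'x^'x \<Rightarrow> bool" where
  "stabilizing M S X \<longleftrightarrow> schur_stable (mA M ** matrix_inv X ** S)"

text \<open>Minimality is with respect to the Loewner order on the \<open>S\<close> component.\<close>

definition minimal_fixed_point :: "real^'x^'x \<Rightarrow> real
    \<Rightarrow> ('x::finite, 'u::finite, 'w::finite, 'y::finite, 'v::finite) model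
    \<Rightarrow> real^'x^'x \<Rightarrow> real^'x^'x \<Rightarrow> real^'y^'x \<Rightarrow> bool" where
  "minimal_fixed_point Q \<gamma> M S X L \<longleftrightarrow>
     pd_fixed_point Q \<gamma> M S X L \<and>
     (\<forall>S' X' L'. pd_fixed_point Q \<gamma> M S' X' L' \<and> pos_semidef (S - S') \<longrightarrow> S' = S)"


section \<open>The principal problem\<close>

text \<open>A policy maps the lists \<open>[z\<^sub>0, \<dots>, z\<^sub>t]\<close>, \<open>[u\<^sub>0, \<dots>, u\<^sub>t\<^sub>-\<^sub>1]\<close> and \<open>[d\<^sub>0, \<dots>, d\<^sub>t\<^sub>-\<^sub>1]\<close> to \<open>u\<^sub>t\<close>.\<close>

type_synonym ('z, 'u, 'd) pr_policy =
  "(real^'z) list \<Rightarrow> (real^'u) list \<Rightarrow> (real^'d) list \<Rightarrow> real^'u"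

definition pr_model_set :: "(real^('z::finite + 'u::finite + 'd::finite)^('z + 'u + 'd)) set \<Rightarrow> bool" where
  "pr_model_set \<H> \<longleftrightarrow> compact \<H> \<and>
     (\<forall>H\<in>\<H>. transpose H = H \<and>
            neg_def (submatrix ixd ixd H) \<and>
            pos_semidef (schur_dd H) \<and>
            pos_def (submatrix Inr Inr (schur_dd H)))"

function (sequential)
  pr_state :: "real^'z^'z \<Rightarrow> real^'u^'z \<Rightarrow> real^'d^'z \<Rightarrow> real^'z
    \<Rightarrow> ('z::finite, 'u::finite, 'd::finite) pr_policy \<Rightarrow> (nat \<Rightarrow> real^'d) \<Rightarrow> nat \<Rightarrow> real^'z" and
  pr_input :: "real^'z^'z \<Rightarrow> real^'u^'z \<Rightarrow> real^'d^'z \<Rightarrow> real^'z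
    \<Rightarrow> ('z::finite, 'u::finite, 'd::finite) pr_policy \<Rightarrow> (nat \<Rightarrow> real^'d) \<Rightarrow> nat \<Rightarrow> real^'u" where
  "pr_state A B G z0 \<mu> d 0 = z0"
| "pr_state A B G z0 \<mu> d (Suc t) =
     A *v pr_state A B G z0 \<mu> d t + B *v pr_input A B G z0 \<mu> d t + G *v d t"
| "pr_input A B G z0 \<mu> d t =
     \<mu> (map (pr_state A B G z0 \<mu> d) [0..<Suc t]) (map (pr_input A B G z0 \<mu> d) [0..<t]) (map d [0..<t])"
  by pat_completeness auto
termination
  by (relation "Wellfounded.measure (case_sum (\<lambda>(A, B, G, z0, \<mu>, d, t). 2 * t)
                                  (\<lambda>(A, B, G, z0, \<mu>, d, t). Suc (2 * t)))") auto

declare pr_input.simps [simp del]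

definition pr_cost :: "real^'z^'z \<Rightarrow> real^'u^'z \<Rightarrow> real^'d^'z \<Rightarrow> nat
    \<Rightarrow> ('z::finite, 'u::finite, 'd::finite) pr_policy \<Rightarrow> real^'z
    \<Rightarrow> real^('z + 'u + 'd)^('z + 'u + 'd) \<Rightarrow> (nat \<Rightarrow> real^'d) \<Rightarrow> real" where
  "pr_cost A B G N \<mu> z0 H d =
     (\<Sum>t<N. sigma3 H (pr_state A B G z0 \<mu> d t) (pr_input A B G z0 \<mu> d t) (d t))"

definition pr_sup :: "real^'z^'z \<Rightarrow> real^'u^'z \<Rightarrow> real^'d^'z
    \<Rightarrow> (real^('z + 'u + 'd)^('z + 'u + 'd)) set \<Rightarrow> real^'z
    \<Rightarrow> ('z::finite, 'u::finite, 'd::finite) pr_policy \<Rightarrow> ereal" where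
  "pr_sup A B G \<H> z0 \<mu> = (SUP (H, d, N) \<in> \<H> \<times> UNIV \<times> UNIV. ereal (pr_cost A B G N \<mu> z0 H d))"

definition pr_value :: "real^'z^'z \<Rightarrow> real^'u^'z \<Rightarrow> real^'d^'z
    \<Rightarrow> (real^('z::finite + 'u::finite + 'd::finite)^('z + 'u + 'd)) set \<Rightarrow> real^'z \<Rightarrow> ereal" where
  "pr_value A B G \<H> z0 = (INF \<mu>. pr_sup A B G \<H> z0 \<mu>)"


section \<open>The reduction\<close>

definition obs_A :: "('x::finite, 'u::finite, 'w::finite, 'y::finite, 'v::finite) model
    \<Rightarrow> real^'x^'x \<Rightarrow> real^'x^'x \<Rightarrow> real^'x^'x" where
  "obs_A M S X = mA M ** matrix_inv X ** S"

definition obs_Q :: "real^'x^'x \<Rightarrow> real^'u^'u \<Rightarrow> real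
    \<Rightarrow> ('x::finite, 'u::finite, 'w::finite, 'y::finite, 'v::finite) model
    \<Rightarrow> real^'x^'x \<Rightarrow> real^'x^'x \<Rightarrow> real^('x + 'u + 'y)^('x + 'u + 'y)" where
  "obs_Q Q R \<gamma> M S X = sym_block3
     (S ** matrix_inv X ** S - S)
     0
     (\<gamma>\<^sup>2 *\<^sub>R (S ** matrix_inv X ** transpose (mC M) ** matrix_inv (ric_W M)))
     R
     0
     (- matrix_inv ((1 / \<gamma>\<^sup>2) *\<^sub>R ric_W M + mC M ** matrix_inv (S - Q) ** transpose (mC M)))"

primrec obs_state :: "real^'x^'x \<Rightarrow> real^'u^'x \<Rightarrow> real^'y^'x \<Rightarrow> real^'x
    \<Rightarrow> (nat \<Rightarrow> real^'u) \<Rightarrow> (nat \<Rightarrow> real^'y) \<Rightarrow> nat \<Rightarrow> real^'x" where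
  "obs_state Ah Bh Gh xhat0 u y 0 = xhat0"
| "obs_state Ah Bh Gh xhat0 u y (Suc t) =
     Ah *v obs_state Ah Bh Gh xhat0 u y t + Bh *v u t + Gh *v y t"

text \<open>\<open>implements \<zeta> \<mu> \<mu>h\<close> says that
  \<open>\<mu>(y\<^sub>0,\<dots>,y\<^sub>t\<^sub>-\<^sub>1, u\<^sub>0,\<dots>,u\<^sub>t\<^sub>-\<^sub>1) = \<mu>h(z\<^sub>0,\<dots>,z\<^sub>t, u\<^sub>0,\<dots>,u\<^sub>t\<^sub>-\<^sub>1, y\<^sub>0,\<dots>,y\<^sub>t\<^sub>-\<^sub>1)\<close> where \<open>z = \<zeta> u y\<close>.
  Existence of such a \<open>\<mu>\<close> is the feasibility of the right-hand side as an output-feedback policy: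
  it has to depend on nothing but \<open>y\<^sub>s\<close> and \<open>u\<^sub>s\<close> for \<open>s < t\<close>.\<close>

definition implements :: "((nat \<Rightarrow> real^'u) \<Rightarrow> (nat \<Rightarrow> real^'y) \<Rightarrow> nat \<Rightarrow> real^'z)
    \<Rightarrow> ('y::finite, 'u::finite) of_policy \<Rightarrow> ('z::finite, 'u, 'y) pr_policy \<Rightarrow> bool" where
  "implements \<zeta> \<mu> \<mu>h \<longleftrightarrow>
     (\<forall>t u y. \<mu> (map y [0..<t]) (map u [0..<t])
            = \<mu>h (map (\<zeta> u y) [0..<Suc t]) (map u [0..<t]) (map y [0..<t]))"

end

theory Submission
  imports Defs
begin

text \<open>
  The reduction is forward dynamic programming (a cost-to-come argument). Fix a model, an output
  sequence \<open>y\<close> and the input sequence \<open>u\<close> that the policy produces from it. The claim is that the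
  largest cost that the past can have accrued, among all initial states and disturbances
  that explain \<open>y\<close> and lead to the state \<open>x\<close> at time \<open>N\<close>, is
  \<open>- |x - xh\<^sub>N|\<^sub>S\<^sup>2 + (\<Sum>t<N. \<sigma>(xh\<^sub>t, u\<^sub>t, y\<^sub>t))\<close>,
  where \<open>xh\<close> is the observer state and \<open>\<sigma>\<close> the quadratic form of \<open>obs_Q\<close>.
  The initial penalty is exactly this expression at \<open>N = 0\<close>,
  because the weight of the initial state is the fixed point \<open>S\<close> itself; hence the quadratic part is
  never changed by the recursion.

  One step of the recursion rests on two least-norm problems. The measurement noise \<open>v\<close> has to produce
  the residual \<open>y - C x\<close>, at the least possible norm. What is then left of the cost at time \<open>t\<close> is a
  quadratic function of the state \<open>x\<close> with leading part \<open>- |x|\<^sub>X\<^sup>2\<close>, and completing the square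
  separates the stage cost \<open>\<sigma>\<close> of the principal problem from the squared distance of \<open>x\<close> to a corrected
  estimate (\<open>stage_eq_squares\<close>); Woodbury's identity turns the block \<open>yy\<close> that arises into the
  one in the definition of \<open>obs_Q\<close>. Finally the pair of \<open>x\<close> and the process noise \<open>w\<close> has to reach the
  next state, which is a weighted least-norm problem. Its value is the quadratic form
  of \<open>(A X\<^sup>-\<^sup>1 A\<^sup>T + \<gamma>\<^sup>-\<^sup>2 G G\<^sup>T)\<^sup>-\<^sup>1 = S\<close>, around the next observer state. Full row rank
  of \<open>[A G]\<close> and of \<open>D\<close> says that these least-norm problems are solvable, whatever their right-hand side.

  Since \<open>S\<close> is positive definite, maximizing over the final state removes the first term, and the bound
  is attained by tracking backwards from \<open>x\<^sub>N = xh\<^sub>N\<close> (\<open>of_cost_le\<close>, \<open>of_cost_attained\<close>). So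
  for every output sequence, model and horizon the worst case cost is the cost of the principal problem.
  The observers are causal functions of \<open>y\<close> and \<open>u\<close>; therefore a policy that reads them can be run in the
  output-feedback problem, and an output-feedback policy is a principal policy that
  ignores them. This yields equality of the suprema for corresponding policies and so of the values.

  If \<open>S - Q\<close> is positive definite, then \<open>H\<^sup>d\<^sup>d\<close> is negative definite, as minus the inverse of a sum of a
  positive definite and a positive semidefinite matrix. The quadratic form of \<open>H/H\<^sup>d\<^sup>d\<close> is then
  the maximum of \<open>\<sigma>\<^sub>H(z,u,d)\<close> over \<open>d\<close>, and already the output \<open>d = C xh\<^sub>i\<close> that confirms the observer
  makes \<open>\<sigma>\<^sub>H(z,u,d)\<close> at least \<open>|u|\<^sub>R\<^sup>2\<close>.
\<close>

section \<open>Definite matrices and completion of squares\<close>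

text \<open>Row vectors times matrices do not occur below: a transpose inside an inner product is
  always moved to the other side by \<open>inner_transpose_right\<close>.\<close>

declare transpose_matrix_vector [simp del] vector_transpose_matrix [simp del]

lemma transpose_plus: "transpose (P + T) = transpose P + transpose (T :: real^'n^'m)"
  and transpose_diff: "transpose (P - T) = transpose P - transpose T"
  and transpose_uminus: "transpose (- P) = - transpose P"
  by (simp_all add: transpose_def vec_eq_iff)

lemma inner_transpose_right: "x \<bullet> (transpose P *v y) = (P *v x) \<bullet> (y :: real^'m)"
  by (metis dot_lmul_matrix inner_commute transpose_matrix_vector)

lemma uminus_matrix_vector: "(- P) *v x = - (P *v (x :: real^'n))"
  by (simp add: vec_eq_iff matrix_vector_mult_def sum_negf)

lemma matrix_vector_uminus: "P *v (- x) = - (P *v (x :: real^'n))"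
  by (simp add: vec_eq_iff matrix_vector_mult_def sum_negf)

lemma inner_symmetric_swap:
  fixes P :: "real^'n^'n"
  assumes "transpose P = P"
  shows "x \<bullet> (P *v y) = y \<bullet> (P *v x)"
  by (metis assms inner_commute inner_transpose_right)

lemma inverse_mult:
  fixes P :: "real^'n^'n"
  assumes "invertible P"
  shows "P ** matrix_inv P = mat 1" "matrix_inv P ** P = mat 1"
  using assms unfolding invertible_def matrix_inv_def
  by (metis (mono_tags, lifting) someI_ex)+

lemma inverse_vector_cancel:
  fixes P :: "real^'n^'n"
  assumes "invertible P"
  shows "P *v (matrix_inv P *v x) = x" "matrix_inv P *v (P *v x) = x"
  by (simp_all add: matrix_vector_mul_assoc inverse_mult[OF assms])

lemma matrix_inv_eqI:
  fixes P :: "real^'n^'n"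
  assumes "P ** T = mat 1"
  shows "matrix_inv P = T"
  by (metis assms inverse_mult(2) invertible_right_inverse matrix_mul_assoc matrix_mul_lid
      matrix_mul_rid)

lemma transpose_matrix_inv:
  fixes P :: "real^'n^'n"
  assumes "invertible P" "transpose P = P"
  shows "transpose (matrix_inv P) = matrix_inv P"
  by (metis assms inverse_mult(2) matrix_inv_eqI matrix_transpose_mul transpose_mat)

lemma pos_def_invertible:
  assumes "pos_def P"
  shows "invertible P"
proof -
  have "x = 0" if "P *v x = 0" for x
    using assms that unfolding pos_def_def by (metis inner_zero_right less_irrefl)
  then show ?thesis
    using invertible_left_inverse matrix_left_invertible_ker by blast
qed

lemma pos_def_matrix_inv:
  assumes "pos_def P"
  shows "pos_def (matrix_inv P)"
  unfolding pos_def_def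
proof (intro conjI allI impI)
  have inv: "invertible P"
    using assms by (rule pos_def_invertible)
  show "transpose (matrix_inv P) = matrix_inv P"
    using assms inv by (simp add: transpose_matrix_inv pos_def_def)
  fix x :: "real^'a"
  assume "x \<noteq> 0"
  then have "matrix_inv P *v x \<noteq> 0"
    by (metis inv inverse_vector_cancel(1) matrix_vector_mult_0_right)
  then have "0 < (matrix_inv P *v x) \<bullet> (P *v (matrix_inv P *v x))"
    using assms unfolding pos_def_def by blast
  then show "0 < x \<bullet> (matrix_inv P *v x)"
    by (simp add: inverse_vector_cancel[OF inv] inner_commute)
qed

lemma wnorm2_nonneg: "pos_def P \<Longrightarrow> 0 \<le> wnorm2 P x"
  unfolding pos_def_def wnorm2_def by (cases "x = 0") (auto intro: less_imp_le)

lemma wnorm2_diff: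
  assumes "transpose P = P"
  shows "wnorm2 P (x - y) = wnorm2 P x - 2 * (x \<bullet> (P *v y)) + wnorm2 P y"
  unfolding wnorm2_def
  using inner_symmetric_swap[OF assms, of x y]
  by (simp add: algebra_simps)

text \<open>The matrix whose inverse gives the value of a weighted least-norm problem for \<open>[A G]\<close>, with
  weight \<open>X\<close> on the first component and the scalar weight \<open>c\<close> on the second one.\<close>

definition weighted_gram ::
  "real^'n^'m \<Rightarrow> real^'k^'m \<Rightarrow> real^'n^'n \<Rightarrow> real \<Rightarrow> real^'m^'m" where
  "weighted_gram A G X c = A ** matrix_inv X ** transpose A + (1 / c) *\<^sub>R (G ** transpose G)"

lemma weighted_gram_vector:
  "weighted_gram A G X c *v p
     = A *v (matrix_inv X *v (transpose A *v p)) + G *v ((1 / c) *\<^sub>R (transpose G *v p))"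
  unfolding weighted_gram_def
  by (simp add: matrix_vector_mult_add_rdistrib matrix_vector_mul_assoc[symmetric]
      scaleR_matrix_vector_assoc[symmetric] matrix_vector_mult_scaleR)

text \<open>If \<open>[A G]\<close> is onto, its transpose has trivial kernel: writing \<open>p = A x + G w\<close>, the number
  \<open>p \<bullet> p\<close> pairs \<open>x\<close> with \<open>A\<^sup>T p\<close> and \<open>w\<close> with \<open>G\<^sup>T p\<close>, so not both of these vectors vanish.\<close>

lemma pos_def_weighted_gram:
  fixes A :: "real^'n^'m" and G :: "real^'k^'m"
  assumes X: "pos_def X" and c: "0 < c" and onto: "\<And>e. \<exists>x w. A *v x + G *v w = e"
  shows "pos_def (weighted_gram A G X c)"
  unfolding pos_def_def
proof (intro conjI allI impI)
  have Xi: "pos_def (matrix_inv X)"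
    using X by (rule pos_def_matrix_inv)
  then show "transpose (weighted_gram A G X c) = weighted_gram A G X c"
    unfolding weighted_gram_def
    by (simp add: transpose_plus transpose_scalar matrix_transpose_mul matrix_mul_assoc pos_def_def)
  fix p :: "real^'m"
  assume "p \<noteq> 0"
  obtain x w where xw: "A *v x + G *v w = p"
    using onto by blast
  have form: "p \<bullet> (weighted_gram A G X c *v p)
      = wnorm2 (matrix_inv X) (transpose A *v p) + (1 / c) * (norm (transpose G *v p))\<^sup>2"
    unfolding weighted_gram_vector wnorm2_def power2_norm_eq_inner
    by (simp add: inner_add_right matrix_vector_mult_scaleR)
      (metis inner_commute inner_transpose_right)
  have "0 < p \<bullet> p"
    using \<open>p \<noteq> 0\<close> by simp
  also have "p \<bullet> p = x \<bullet> (transpose A *v p) + w \<bullet> (transpose G *v p)"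
    by (simp add: inner_transpose_right inner_add_left[symmetric] xw)
  finally have "transpose A *v p \<noteq> 0 \<or> transpose G *v p \<noteq> 0"
    by auto
  then show "0 < p \<bullet> (weighted_gram A G X c *v p)"
  proof
    assume "transpose A *v p \<noteq> 0"
    then have "0 < wnorm2 (matrix_inv X) (transpose A *v p)"
      using Xi unfolding pos_def_def wnorm2_def by blast
    then show ?thesis
      using c by (simp add: form add_pos_nonneg)
  next
    assume "transpose G *v p \<noteq> 0"
    then have "0 < (1 / c) * (norm (transpose G *v p))\<^sup>2"
      using c by simp
    then show ?thesis
      using wnorm2_nonneg[OF Xi] by (simp add: form add_nonneg_pos)
  qed
qed

text \<open>The minimizer \<open>(X\<^sup>-\<^sup>1 A\<^sup>T p, c\<^sup>-\<^sup>1 G\<^sup>T p)\<close> with \<open>p = K\<^sup>-\<^sup>1 e\<close> comes from the Lagrange conditions. Its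
  weighted inner product with a feasible pair depends only on \<open>e\<close>, so the squared weighted distance of a feasible
  pair from the minimizer is its excess cost.\<close>

lemma weighted_least_norm:
  fixes A :: "real^'n^'m" and G :: "real^'k^'m"
  assumes X: "pos_def X" and c: "0 < c" and onto: "\<And>e. \<exists>x w. A *v x + G *v w = e"
  defines "K \<equiv> weighted_gram A G X c"
  shows "wnorm2 (matrix_inv K) (A *v x + G *v w) \<le> wnorm2 X x + c * (norm w)\<^sup>2"
    and "\<exists>x w. A *v x + G *v w = e
               \<and> wnorm2 X x + c * (norm w)\<^sup>2 = wnorm2 (matrix_inv K) e"
proof -
  define xo where "xo e = matrix_inv X *v (transpose A *v (matrix_inv K *v e))" for e
  define wo where "wo e = (1 / c) *\<^sub>R (transpose G *v (matrix_inv K *v e))" for e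
  have Xt: "transpose X = X" and Xinv: "invertible X"
    using X by (auto simp: pos_def_def pos_def_invertible)
  have Kinv: "invertible K"
    unfolding K_def by (intro pos_def_invertible pos_def_weighted_gram X c onto)
  have hit: "A *v xo e + G *v wo e = e" for e
    unfolding xo_def wo_def weighted_gram_vector[symmetric] K_def[symmetric]
    by (rule inverse_vector_cancel(1)[OF Kinv])
  have pairing: "x \<bullet> (X *v xo e) + c * (w \<bullet> wo e) = (A *v x + G *v w) \<bullet> (matrix_inv K *v e)"
    for x w e
    unfolding xo_def wo_def using c
    by (simp add: inverse_vector_cancel[OF Xinv] inner_transpose_right inner_add_left)
  have val: "wnorm2 X (xo e) + c * (norm (wo e))\<^sup>2 = wnorm2 (matrix_inv K) e" for e
    using pairing[of "xo e" e "wo e"] by (simp add: hit wnorm2_def power2_norm_eq_inner)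
  show "\<exists>x w. A *v x + G *v w = e \<and> wnorm2 X x + c * (norm w)\<^sup>2 = wnorm2 (matrix_inv K) e"
    using hit val by blast
  let ?e = "A *v x + G *v w"
  have "0 \<le> wnorm2 X (x - xo ?e) + c * (norm (w - wo ?e))\<^sup>2"
    using wnorm2_nonneg[OF X] c by (intro add_nonneg_nonneg) auto
  also have "\<dots> = wnorm2 X x + c * (norm w)\<^sup>2
      - 2 * (x \<bullet> (X *v xo ?e) + c * (w \<bullet> wo ?e)) + (wnorm2 X (xo ?e) + c * (norm (wo ?e))\<^sup>2)"
    by (simp add: wnorm2_diff[OF Xt] power2_norm_eq_inner algebra_simps inner_commute)
  also have "\<dots> = wnorm2 X x + c * (norm w)\<^sup>2 - wnorm2 (matrix_inv K) ?e"
    unfolding pairing val by (simp add: wnorm2_def)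
  finally show "wnorm2 (matrix_inv K) ?e \<le> wnorm2 X x + c * (norm w)\<^sup>2"
    by simp
qed

text \<open>The unweighted problem for a single matrix is the case \<open>A = 0\<close>, \<open>X = 1\<close>, \<open>c = 1\<close> of the weighted one;
  the first component then contributes nothing to the constraint and only adds to the cost.\<close>

lemma least_norm_solution:
  fixes D :: "real^'k^'m"
  assumes onto: "surj ((*v) D)"
  shows "wnorm2 (matrix_inv (D ** transpose D)) (D *v v) \<le> (norm v)\<^sup>2"
    and "\<exists>v. D *v v = e \<and> (norm v)\<^sup>2 = wnorm2 (matrix_inv (D ** transpose D)) e"
    and "pos_def (D ** transpose D)"
proof -
  have id: "pos_def (mat 1 :: real^'m^'m)"
    by (simp add: pos_def_def)
  have gram: "weighted_gram (0 :: real^'m^'m) D (mat 1) 1 = D ** transpose D"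
    by (simp add: weighted_gram_def)
  have onto': "\<exists>x w. (0 :: real^'m^'m) *v x + D *v w = e" for e
    using onto by (simp add: surj_def) metis
  note least = weighted_least_norm[OF id _ onto', of 1, unfolded gram]
  show "wnorm2 (matrix_inv (D ** transpose D)) (D *v v) \<le> (norm v)\<^sup>2"
    using least(1)[of 0 v] by (simp add: wnorm2_def)
  show "pos_def (D ** transpose D)"
    using pos_def_weighted_gram[OF id _ onto', of 1, unfolded gram] by simp
  obtain x :: "real^'m" and v where v: "D *v v = e"
      "wnorm2 (mat 1) x + (norm v)\<^sup>2 = wnorm2 (matrix_inv (D ** transpose D)) e"
    using least(2)[of e] by auto
  have "(norm v)\<^sup>2 \<le> wnorm2 (matrix_inv (D ** transpose D)) e"
    using v(2) wnorm2_nonneg[OF id, of x] by simp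
  with least(1)[of 0 v] v(1)
  show "\<exists>v. D *v v = e \<and> (norm v)\<^sup>2 = wnorm2 (matrix_inv (D ** transpose D)) e"
    by (intro exI[of _ v]) (simp add: wnorm2_def)
qed

text \<open>For a given \<open>y\<close>, the vector \<open>r\<close> below is the right-hand side applied to \<open>y\<close>. The
  defining equation \<open>X q = C\<^sup>T U y\<close> of \<open>q\<close> amounts to \<open>C\<^sup>T r = T q\<close>, so that \<open>C q\<close> cancels
  when \<open>V + C T\<^sup>-\<^sup>1 C\<^sup>T\<close> is applied to \<open>r\<close>.\<close>

lemma woodbury_inverse:
  fixes T X :: "real^'n^'n" and U V :: "real^'m^'m" and C :: "real^'n^'m"
  assumes VU: "V ** U = mat 1" and T: "invertible T" and Xinv: "invertible X"
    and X: "X = T + transpose C ** U ** C"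
  shows "matrix_inv (V + C ** matrix_inv T ** transpose C)
       = U - U ** C ** matrix_inv X ** transpose C ** U"
proof (rule matrix_inv_eqI, unfold matrix_eq, rule allI)
  fix y
  define q where "q = matrix_inv X *v (transpose C *v (U *v y))"
  define r where "r = U *v y - U *v (C *v q)"
  have "X *v q = transpose C *v (U *v y)"
    unfolding q_def by (rule inverse_vector_cancel(1)[OF Xinv])
  then have "transpose C *v r = T *v q"
    unfolding r_def X
    by (simp add: algebra_simps matrix_vector_mul_assoc[symmetric])
  then have "C *v (matrix_inv T *v (transpose C *v r)) = C *v q"
    by (simp add: inverse_vector_cancel(2)[OF T])
  moreover have "V *v r = y - C *v q"
    by (simp add: r_def matrix_vector_mult_diff_distrib matrix_vector_mul_assoc matrix_mul_assoc VU)
  ultimately have "(V + C ** matrix_inv T ** transpose C) *v r = y"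
    by (simp add: matrix_vector_mult_add_rdistrib matrix_vector_mul_assoc[symmetric])
  moreover have "(U - U ** C ** matrix_inv X ** transpose C ** U) *v y = r"
    unfolding r_def q_def
    by (simp add: matrix_vector_mult_diff_rdistrib matrix_vector_mul_assoc[symmetric])
  ultimately show "((V + C ** matrix_inv T ** transpose C)
      ** (U - U ** C ** matrix_inv X ** transpose C ** U)) *v y = mat 1 *v y"
    by (simp add: matrix_vector_mul_assoc[symmetric])
qed

section \<open>Block matrices and Schur complements\<close>

lemma sum_UNIV_Plus:
  fixes f :: "'a::finite + 'b::finite \<Rightarrow> real"
  shows "sum f UNIV = (\<Sum>i\<in>UNIV. f (Inl i)) + (\<Sum>j\<in>UNIV. f (Inr j))"
  by (simp add: UNIV_Plus_UNIV[symmetric] sum.Plus del: UNIV_Plus_UNIV)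

definition part_l :: "real^('a::finite + 'b::finite) \<Rightarrow> real^'a" where
  "part_l a = (\<chi> i. a $ Inl i)"

definition part_r :: "real^('a::finite + 'b::finite) \<Rightarrow> real^'b" where
  "part_r a = (\<chi> j. a $ Inr j)"

lemma submatrix_vector_split:
  "submatrix f (case_sum g h) H *v a = submatrix f g H *v part_l a + submatrix f h H *v part_r a"
  by (simp add: vec_eq_iff matrix_vector_mult_def submatrix_def sum_UNIV_Plus part_l_def part_r_def)

lemma inner_submatrix_split:
  "a \<bullet> (submatrix (case_sum g h) f H *v x)
     = part_l a \<bullet> (submatrix g f H *v x) + part_r a \<bullet> (submatrix h f H *v x)"
  by (simp add: inner_vec_def matrix_vector_mult_def submatrix_def sum_UNIV_Plus part_l_def
      part_r_def)

lemma transpose_submatrix: "transpose (submatrix f g H) = submatrix g f (transpose H)"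
  by (simp add: transpose_def submatrix_def vec_eq_iff)

text \<open>The Schur complement is the result of maximizing over \<open>d\<close>: completing the square in \<open>d\<close> leaves
  a nonpositive term that vanishes at the maximizer.\<close>

lemma sigma3_le_schur_dd:
  assumes H: "transpose H = H" and dd: "neg_def (submatrix ixd ixd H)"
  shows "sigma3 H (part_l a) (part_r a) d \<le> a \<bullet> (schur_dd H *v a)"
proof -
  let ?zu = "case_sum ixz ixu"
  define E where "E = submatrix ?zu ?zu H"
  define F where "F = submatrix ixd ?zu H"
  define P where "P = - submatrix ixd ixd H"
  have P: "pos_def P" and Pt: "transpose P = P"
    using dd by (auto simp: neg_def_def P_def pos_def_def)
  have Pinv: "invertible P"
    using P by (rule pos_def_invertible)
  have dd_inv: "matrix_inv (submatrix ixd ixd H) = - matrix_inv P"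
    using inverse_vector_cancel(1)[OF Pinv]
    by (intro matrix_inv_eqI) (simp add: P_def matrix_eq matrix_vector_mul_assoc[symmetric]
        uminus_matrix_vector matrix_vector_uminus)
  have Ft: "submatrix ?zu ixd H = transpose F"
    unfolding F_def transpose_submatrix H ..
  have schur: "schur_dd H = E + transpose F ** matrix_inv P ** F"
    unfolding schur_dd_def Let_def dd_inv Ft E_def F_def
    by (simp add: matrix_eq matrix_vector_mul_assoc[symmetric] matrix_vector_mult_diff_rdistrib
        matrix_vector_mult_add_rdistrib uminus_matrix_vector matrix_vector_uminus)
  have form: "a \<bullet> (schur_dd H *v a) = a \<bullet> (E *v a) + (F *v a) \<bullet> (matrix_inv P *v (F *v a))"
    unfolding schur
    by (simp add: matrix_vector_mult_add_rdistrib matrix_vector_mul_assoc[symmetric]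
        inner_add_right inner_transpose_right)
  have "sigma3 H (part_l a) (part_r a) d
      = a \<bullet> (E *v a) + a \<bullet> (transpose F *v d) + d \<bullet> (F *v a) + d \<bullet> (submatrix ixd ixd H *v d)"
    unfolding sigma3_def E_def F_def Ft[unfolded F_def, symmetric]
    by (simp add: submatrix_vector_split inner_submatrix_split inner_add_right)
  also have "\<dots> = a \<bullet> (E *v a) + 2 * (d \<bullet> (F *v a)) - wnorm2 P d"
    by (simp add: inner_transpose_right inner_commute wnorm2_def P_def uminus_matrix_vector)
  also have "\<dots> = a \<bullet> (E *v a) + (F *v a) \<bullet> (matrix_inv P *v (F *v a))
      - wnorm2 P (d - matrix_inv P *v (F *v a))"
    unfolding wnorm2_diff[OF Pt]
    by (simp add: inverse_vector_cancel[OF Pinv] wnorm2_def inner_commute)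
  also have "\<dots> \<le> a \<bullet> (schur_dd H *v a)"
    using wnorm2_nonneg[OF P] by (simp add: form)
  finally show ?thesis .
qed

lemma transpose_schur_dd:
  assumes H: "transpose H = H" and dd: "neg_def (submatrix ixd ixd H)"
  shows "transpose (schur_dd H) = schur_dd H"
proof -
  have "invertible (- submatrix ixd ixd H)"
    using dd unfolding neg_def_def by (rule pos_def_invertible)
  from scalar_invertible[OF _ this, of "-1"] have "invertible (submatrix ixd ixd H)"
    by simp
  then show ?thesis
    by (simp add: schur_dd_def Let_def transpose_diff matrix_transpose_mul matrix_mul_assoc
        transpose_matrix_inv transpose_submatrix H)
qed

text \<open>Because of the maximum property, a lower bound for the Schur complement needs only one good response
  \<open>d\<close> to each \<open>(z, u)\<close>, instead of the inverse of the \<open>dd\<close> block.\<close>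

lemma schur_dd_definite:
  fixes H :: "real^('z::finite + 'u::finite + 'd::finite)^('z + 'u + 'd)"
  assumes H: "transpose H = H" and dd: "neg_def (submatrix ixd ixd H)"
    and R: "pos_def R" and response: "\<And>z u. \<exists>d. wnorm2 R u \<le> sigma3 H z u d"
  shows "pos_semidef (schur_dd H)" "pos_def (submatrix Inr Inr (schur_dd H))"
proof -
  have bound: "wnorm2 R (part_r a) \<le> a \<bullet> (schur_dd H *v a)" for a
    using response[of "part_r a" "part_l a"] sigma3_le_schur_dd[OF H dd] order_trans by blast
  then show "pos_semidef (schur_dd H)"
    unfolding pos_semidef_def
    using transpose_schur_dd[OF H dd] wnorm2_nonneg[OF R] order_trans by blast
  show "pos_def (submatrix Inr Inr (schur_dd H))"
    unfolding pos_def_def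
  proof (intro conjI allI impI)
    show "transpose (submatrix Inr Inr (schur_dd H)) = submatrix Inr Inr (schur_dd H)"
      by (simp add: transpose_submatrix transpose_schur_dd[OF H dd])
    fix u :: "real^'u"
    assume "u \<noteq> 0"
    define a :: "real^('z + 'u)" where "a = (\<chi> k. case k of Inl i \<Rightarrow> 0 | Inr j \<Rightarrow> u $ j)"
    have parts: "part_r a = u"
      by (simp add: a_def part_r_def)
    have "0 < wnorm2 R u"
      using R \<open>u \<noteq> 0\<close> by (simp add: pos_def_def wnorm2_def)
    also have "\<dots> \<le> a \<bullet> (schur_dd H *v a)"
      using bound[of a] by (simp add: parts)
    also have "\<dots> = u \<bullet> (submatrix Inr Inr (schur_dd H) *v u)"
      by (simp add: inner_vec_def matrix_vector_mult_def submatrix_def sum_UNIV_Plus a_def)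
    finally show "0 < u \<bullet> (submatrix Inr Inr (schur_dd H) *v u)" .
  qed
qed

lemma submatrix_sym_block3:
  "submatrix ixz ixz (sym_block3 Hzz Hzu Hzd Huu Hud Hdd) = Hzz"
  "submatrix ixz ixu (sym_block3 Hzz Hzu Hzd Huu Hud Hdd) = Hzu"
  "submatrix ixz ixd (sym_block3 Hzz Hzu Hzd Huu Hud Hdd) = Hzd"
  "submatrix ixu ixz (sym_block3 Hzz Hzu Hzd Huu Hud Hdd) = transpose Hzu"
  "submatrix ixu ixu (sym_block3 Hzz Hzu Hzd Huu Hud Hdd) = Huu"
  "submatrix ixu ixd (sym_block3 Hzz Hzu Hzd Huu Hud Hdd) = Hud"
  "submatrix ixd ixz (sym_block3 Hzz Hzu Hzd Huu Hud Hdd) = transpose Hzd"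
  "submatrix ixd ixu (sym_block3 Hzz Hzu Hzd Huu Hud Hdd) = transpose Hud"
  "submatrix ixd ixd (sym_block3 Hzz Hzu Hzd Huu Hud Hdd) = Hdd"
  by (simp_all add: submatrix_def sym_block3_def ixz_def ixu_def ixd_def vcat_def hcat_def vec_eq_iff)

lemma sigma3_sym_block3:
  "sigma3 (sym_block3 Hzz Hzu Hzd Huu Hud Hdd) z u d
     = z \<bullet> (Hzz *v z) + u \<bullet> (Huu *v u) + d \<bullet> (Hdd *v d)
       + 2 * (z \<bullet> (Hzu *v u)) + 2 * (z \<bullet> (Hzd *v d)) + 2 * (u \<bullet> (Hud *v d))"
  unfolding sigma3_def submatrix_sym_block3
  by (simp add: inner_transpose_right inner_commute)

lemma transpose_sym_block3:
  assumes "transpose Hzz = Hzz" "transpose Huu = Huu" "transpose Hdd = Hdd"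
  shows "transpose (sym_block3 Hzz Hzu Hzd Huu Hud Hdd) = sym_block3 Hzz Hzu Hzd Huu Hud Hdd"
proof -
  have entry: "P $ i $ j = P $ j $ i" if "transpose P = P" for P :: "real^'n^'n" and i j
    using that by (metis transpose_def vec_lambda_beta)
  show ?thesis
    by (simp add: transpose_def sym_block3_def vcat_def hcat_def vec_eq_iff entry[OF assms(1)]
        entry[OF assms(2)] entry[OF assms(3)] split: sum.split)
qed

lemma transpose_place: "transpose (place i P) = place i (transpose P)"
  by (auto simp: transpose_def place_def vec_eq_iff split: option.split)

lemma submatrix_place_dd: "submatrix ixd ixd (place i P) = submatrix ixd ixd P"
  by (simp add: submatrix_def place_def ixd_def vec_eq_iff)

lemma stack_vec_surj: "\<exists>f. z = stack_vec f"
  by (rule exI[of _ "\<lambda>i. \<chi> k. z $ (i, k)"]) (simp add: stack_vec_def vec_eq_iff)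

lemma block_diag_vector: "block_diag F *v stack_vec f = stack_vec (\<lambda>i. F i *v f i)"
proof -
  have "(\<Sum>q\<in>UNIV. (if i = fst q then F i $ k $ snd q else 0) * f (fst q) $ snd q)
      = (\<Sum>j\<in>UNIV. F i $ k $ j * f i $ j)" (is "?l = ?r") for i k
  proof -
    have "?l = (\<Sum>q\<in>{i} \<times> UNIV. (if i = fst q then F i $ k $ snd q else 0) * f (fst q) $ snd q)"
      by (intro sum.mono_neutral_right) auto
    then show ?thesis
      by (simp add: sum.cartesian_product')
  qed
  then show ?thesis
    by (simp add: vec_eq_iff matrix_vector_mult_def block_diag_def stack_vec_def)
qed

lemma stack_mat_vector: "stack_mat F *v u = stack_vec (\<lambda>i. F i *v u)"
  by (simp add: vec_eq_iff matrix_vector_mult_def stack_mat_def stack_vec_def)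

lemma stack_vec_add: "stack_vec f + stack_vec g = stack_vec (\<lambda>i. f i + g i)"
  by (simp add: vec_eq_iff stack_vec_def)

section \<open>The observer of a single model\<close>

lemma hcat_vector: "hcat P T *v a = P *v part_l a + T *v part_r a"
  by (simp add: vec_eq_iff matrix_vector_mult_def hcat_def sum_UNIV_Plus part_l_def part_r_def)

text \<open>A single model together with a positive definite fixed point. Invertibility of \<open>S - Q\<close> makes the
  inverse in the \<open>yy\<close> block of \<open>obs_Q\<close> a genuine one.\<close>

locale observer =
  fixes Q :: "real^'x^'x" and R :: "real^'u^'u" and \<gamma> :: real
    and M :: "('x::finite, 'u::finite, 'w::finite, 'y::finite, 'v::finite) model"
    and S X :: "real^'x^'x" and L :: "real^'y^'x"
  assumes Q: "pos_def Q" and R: "pos_def R" and gamma: "0 < \<gamma>"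
    and rank_dynamics: "rank (hcat (mA M) (mG M)) = CARD('x)"
    and rank_output: "rank (mD M) = CARD('y)"
    and fixed_point: "pd_fixed_point Q \<gamma> M S X L"
    and gap_invertible: "invertible (S - Q)"
begin

text \<open>The weight \<open>\<gamma>\<^sup>2 (D D\<^sup>T)\<^sup>-\<^sup>1\<close> is the price of an output residual, once the measurement noise explains it
  at least norm.\<close>

definition noise_weight :: "real^'y^'y" where
  "noise_weight = \<gamma>\<^sup>2 *\<^sub>R matrix_inv (ric_W M)"

text \<open>The maximizer over \<open>x\<close> of the accrued cost at one time, given the estimate \<open>xh\<close> before and the output
  \<open>y\<close> at that time: an estimate of the present state that has taken \<open>y\<close> into account.\<close>

definition corrected :: "real^'x \<Rightarrow> real^'y \<Rightarrow> real^'x" where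
  "corrected xh y = matrix_inv X *v (S *v xh + transpose (mC M) *v (noise_weight *v y))"

definition stage :: "real^'x \<Rightarrow> real^'u \<Rightarrow> real^'y \<Rightarrow> real" where
  "stage xh u y = sigma3 (obs_Q Q R \<gamma> M S X) xh u y"

definition observer_step :: "real^'x \<Rightarrow> real^'u \<Rightarrow> real^'y \<Rightarrow> real^'x" where
  "observer_step xh u y = obs_A M S X *v xh + mB M *v u + L *v y"

lemma dynamics_onto: "\<exists>x w. mA M *v x + mG M *v w = e"
  using rank_dynamics unfolding full_rank_surjective surj_def hcat_vector by metis

lemma output_onto: "surj ((*v) (mD M))"
  using rank_output by (simp add: full_rank_surjective)

lemma pos_def_S: "pos_def S" and pos_def_X: "pos_def X"
  using fixed_point unfolding pd_fixed_point_def by blast+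

lemma transposes: "transpose S = S" "transpose X = X" "transpose Q = Q" "transpose R = R"
  using pos_def_S pos_def_X Q R by (auto simp: pos_def_def)

lemma invertible_X: "invertible X"
  using pos_def_X by (rule pos_def_invertible)

lemma pos_def_ric_W: "pos_def (ric_W M)"
  unfolding ric_W_def by (rule least_norm_solution(3)[OF output_onto])

lemma transpose_noise_weight: "transpose noise_weight = noise_weight"
  using pos_def_matrix_inv[OF pos_def_ric_W]
  by (simp add: noise_weight_def transpose_scalar pos_def_def)

lemma mult_noise_weight: "P ** noise_weight = \<gamma>\<^sup>2 *\<^sub>R (P ** matrix_inv (ric_W M))"
  by (simp add: noise_weight_def matrix_scalar_ac scalar_matrix_assoc)

lemma wnorm2_noise_weight: "wnorm2 noise_weight e = \<gamma>\<^sup>2 * wnorm2 (matrix_inv (ric_W M)) e"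
  by (simp add: wnorm2_def noise_weight_def scaleR_matrix_vector_assoc[symmetric])

lemma X_eq: "X = (S - Q) + transpose (mC M) ** noise_weight ** mC M"
proof -
  have "X = ric_X Q \<gamma> M S"
    using fixed_point unfolding pd_fixed_point_def by blast
  also have "\<dots> = (S - Q) + transpose (mC M) ** noise_weight ** mC M"
    by (simp add: ric_X_def noise_weight_def matrix_scalar_ac scalar_matrix_assoc)
  finally show ?thesis .
qed

lemma S_eq: "S = matrix_inv (weighted_gram (mA M) (mG M) X (\<gamma>\<^sup>2))"
  using fixed_point unfolding pd_fixed_point_def ric_S_def weighted_gram_def by blast

lemma L_eq: "L = mA M ** matrix_inv X ** transpose (mC M) ** noise_weight"
proof -
  have "L = ric_L \<gamma> M X"
    using fixed_point unfolding pd_fixed_point_def by blast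
  then show ?thesis
    by (simp add: ric_L_def mult_noise_weight)
qed

text \<open>The observer gain \<open>L\<close> and the observer matrix \<open>A X\<^sup>-\<^sup>1 S\<close> are a correction followed by one step of the
  undisturbed dynamics. So the least-norm problem of reaching the next state is centred at
  the next observer state.\<close>

lemma observer_step_corrected: "observer_step xh u y = mA M *v corrected xh y + mB M *v u"
  unfolding observer_step_def corrected_def obs_A_def
  by (simp add: L_eq matrix_vector_mul_assoc[symmetric] matrix_vector_right_distrib)

lemma output_block_eq:
  "matrix_inv ((1 / \<gamma>\<^sup>2) *\<^sub>R ric_W M + mC M ** matrix_inv (S - Q) ** transpose (mC M))
     = noise_weight - noise_weight ** mC M ** matrix_inv X ** transpose (mC M) ** noise_weight"
proof (rule woodbury_inverse[OF _ gap_invertible invertible_X X_eq])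
  show "((1 / \<gamma>\<^sup>2) *\<^sub>R ric_W M) ** noise_weight = mat 1"
    using gamma inverse_mult(1)[OF pos_def_invertible[OF pos_def_ric_W]]
    by (simp add: noise_weight_def matrix_scalar_ac scalar_matrix_assoc[symmetric])
qed

text \<open>The cost accrued at one time is \<open>- |x - corrected|\<^sub>X\<^sup>2\<close> plus a constant in \<open>x\<close>, since
  \<open>X = S + C\<^sup>T U C - Q\<close> (with \<open>U\<close> the noise weight) collects its quadratic terms; the constant is the
  stage cost of the principal problem.\<close>

lemma stage_eq_squares:
  "stage xh u y = - wnorm2 S (x - xh) + wnorm2 Q x + wnorm2 R u
       - wnorm2 noise_weight (y - mC M *v x) + wnorm2 X (x - corrected xh y)"
proof -
  let ?U = noise_weight and ?C = "mC M" and ?Xi = "matrix_inv X"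
  \<comment> \<open>the linear part of the accrued cost in \<open>x\<close>\<close>
  define b where "b = S *v xh + transpose ?C *v (?U *v y)"
  have Xi: "transpose ?Xi = ?Xi"
    using invertible_X transposes by (simp add: transpose_matrix_inv)
  have cross: "\<gamma>\<^sup>2 *\<^sub>R (S ** ?Xi ** transpose ?C ** matrix_inv (ric_W M))
      = S ** ?Xi ** transpose ?C ** ?U"
    by (simp add: mult_noise_weight)
  have "stage xh u y = b \<bullet> (?Xi *v b) - wnorm2 S xh - wnorm2 ?U y + wnorm2 R u"
  proof -
    have "b \<bullet> (?Xi *v b) = (S *v xh) \<bullet> (?Xi *v (S *v xh))
        + 2 * ((S *v xh) \<bullet> (?Xi *v (transpose ?C *v (?U *v y))))
        + (transpose ?C *v (?U *v y)) \<bullet> (?Xi *v (transpose ?C *v (?U *v y)))"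
      using inner_symmetric_swap[OF Xi, of "S *v xh" "transpose ?C *v (?U *v y)"]
      by (simp add: b_def algebra_simps)
    moreover have "(S *v xh) \<bullet> z = xh \<bullet> (S *v z)" for z
      using inner_transpose_right[of xh S z] transposes by simp
    moreover have "(transpose ?C *v (?U *v y)) \<bullet> z = y \<bullet> (?U *v (?C *v z))" for z
      using inner_transpose_right[of y ?U "?C *v z"] inner_transpose_right[of "?U *v y" "transpose ?C" z]
      by (simp add: transpose_noise_weight)
    ultimately show ?thesis
      unfolding stage_def obs_Q_def sigma3_sym_block3 cross output_block_eq wnorm2_def
      by (simp add: matrix_vector_mult_diff_rdistrib uminus_matrix_vector
          matrix_vector_mul_assoc[symmetric] inner_diff_right)
  qed
  moreover have "wnorm2 X (x - corrected xh y) = wnorm2 X x - 2 * (x \<bullet> b) + b \<bullet> (?Xi *v b)"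
    unfolding wnorm2_diff[OF transposes(2)] corrected_def b_def[symmetric]
    by (simp add: wnorm2_def inverse_vector_cancel[OF invertible_X] inner_commute)
  moreover have "wnorm2 X x = wnorm2 S x - wnorm2 Q x + wnorm2 ?U (?C *v x)"
  proof -
    have "X *v x = S *v x - Q *v x + transpose ?C *v (?U *v (?C *v x))"
      by (subst X_eq)
        (simp add: matrix_vector_mult_add_rdistrib matrix_vector_mult_diff_rdistrib
          matrix_vector_mul_assoc[symmetric])
    then show ?thesis
      by (simp add: wnorm2_def inner_add_right inner_diff_right inner_transpose_right)
  qed
  moreover have "x \<bullet> b = x \<bullet> (S *v xh) + y \<bullet> (?U *v (?C *v x))"
    using inner_symmetric_swap[OF transpose_noise_weight, of "?C *v x" y]
    by (simp add: b_def inner_add_right inner_transpose_right)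
  ultimately show ?thesis
    by (simp add: wnorm2_diff[OF transposes(1)] wnorm2_diff[OF transpose_noise_weight])
qed

text \<open>One step of dynamic programming. The least-norm bound for \<open>v\<close> replaces it by the
  residual, \<open>stage_eq_squares\<close> isolates the square in \<open>X\<close>, and the weighted least-norm bound for
  \<open>(x - corrected, w)\<close> turns this square and \<open>w\<close> into the quadratic form of the same matrix \<open>S\<close>, by the
  fixed point equation.\<close>

lemma cost_step_le:
  assumes y: "y = mC M *v x + mD M *v v"
  shows "- wnorm2 S (x - xh) + (wnorm2 Q x + wnorm2 R u - \<gamma>\<^sup>2 * (norm (w, v))\<^sup>2)
       \<le> stage xh u y
         - wnorm2 S (mA M *v x + mB M *v u + mG M *v w - observer_step xh u y)"
proof -
  have "\<gamma>\<^sup>2 * wnorm2 (matrix_inv (ric_W M)) (y - mC M *v x) \<le> \<gamma>\<^sup>2 * (norm v)\<^sup>2"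
    using least_norm_solution(1)[OF output_onto, of v]
    by (intro mult_left_mono) (simp_all add: y ric_W_def)
  moreover have "wnorm2 S (mA M *v x + mB M *v u + mG M *v w - observer_step xh u y)
      \<le> wnorm2 X (x - corrected xh y) + \<gamma>\<^sup>2 * (norm w)\<^sup>2"
    using weighted_least_norm(1)[OF pos_def_X _ dynamics_onto, of "\<gamma>\<^sup>2" "x - corrected xh y" w] gamma
    by (simp add: S_eq[symmetric] observer_step_corrected algebra_simps)
  moreover note stage_eq_squares[of xh u y x]
  ultimately show ?thesis
    by (simp add: wnorm2_noise_weight norm_Pair distrib_left)
qed

text \<open>Both bounds in the preceding step are attained at once, for any prescribed next state \<open>x'\<close>: first \<open>w\<close>
  and the deviation \<open>h\<close> from the corrected estimate are chosen to reach \<open>x'\<close>, then \<open>v\<close> to explain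
  the output at the resulting state.\<close>

lemma cost_step_attained:
  obtains x w v where "mA M *v x + mB M *v u + mG M *v w = x'" "y = mC M *v x + mD M *v v"
    "- wnorm2 S (x - xh) + (wnorm2 Q x + wnorm2 R u - \<gamma>\<^sup>2 * (norm (w, v))\<^sup>2)
       = stage xh u y - wnorm2 S (x' - observer_step xh u y)"
proof -
  obtain h w where hw: "mA M *v h + mG M *v w = x' - observer_step xh u y"
      "wnorm2 X h + \<gamma>\<^sup>2 * (norm w)\<^sup>2 = wnorm2 S (x' - observer_step xh u y)"
    using weighted_least_norm(2)[OF pos_def_X _ dynamics_onto, of "\<gamma>\<^sup>2"] gamma
    unfolding S_eq[symmetric] by (metis zero_less_power)
  define x where "x = corrected xh y + h"
  obtain v where v: "mD M *v v = y - mC M *v x"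
      "(norm v)\<^sup>2 = wnorm2 (matrix_inv (ric_W M)) (y - mC M *v x)"
    using least_norm_solution(2)[OF output_onto] unfolding ric_W_def by metis
  have norm_wv: "(norm (w, v))\<^sup>2 = (norm w)\<^sup>2 + (norm v)\<^sup>2"
    by (simp add: norm_Pair)
  show thesis
  proof
    show "mA M *v x + mB M *v u + mG M *v w = x'"
      using hw(1) by (simp add: x_def observer_step_corrected algebra_simps)
    show "y = mC M *v x + mD M *v v"
      by (simp add: v(1))
    show "- wnorm2 S (x - xh) + (wnorm2 Q x + wnorm2 R u - \<gamma>\<^sup>2 * (norm (w, v))\<^sup>2)
       = stage xh u y - wnorm2 S (x' - observer_step xh u y)"
      using hw(2)[symmetric] stage_eq_squares[of xh u y x]
      by (simp add: wnorm2_noise_weight norm_wv v(2) distrib_left x_def)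
  qed
qed

abbreviation estimate :: "real^'x \<Rightarrow> (nat \<Rightarrow> real^'u) \<Rightarrow> (nat \<Rightarrow> real^'y) \<Rightarrow> nat \<Rightarrow> real^'x" where
  "estimate xh0 u y t \<equiv> obs_state (obs_A M S X) (mB M) L xh0 u y t"

lemma estimate_Suc: "estimate xh0 u y (Suc t) = observer_step (estimate xh0 u y t) (u t) (y t)"
  by (simp add: observer_step_def)

text \<open>The cost of \<open>of_cost\<close> for an arbitrary input sequence, separated from the policy: the dynamic
  programming argument treats \<open>u\<close> and \<open>y\<close> as given.\<close>

definition accrued :: "real^'x \<Rightarrow> (nat \<Rightarrow> real^'u) \<Rightarrow> (nat \<Rightarrow> real^'w) \<Rightarrow> (nat \<Rightarrow> real^'v)
    \<Rightarrow> real^'x \<Rightarrow> nat \<Rightarrow> real" where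
  "accrued xh0 u w v x0 N = - wnorm2 S (x0 - xh0)
     + (\<Sum>t<N. wnorm2 Q (of_state M x0 u w t) + wnorm2 R (u t) - \<gamma>\<^sup>2 * (norm (w t, v t))\<^sup>2)"

lemma accrued_le:
  assumes y: "\<And>t. y t = mC M *v of_state M x0 u w t + mD M *v v t"
  shows "accrued xh0 u w v x0 N \<le> (\<Sum>t<N. stage (estimate xh0 u y t) (u t) (y t))
       - wnorm2 S (of_state M x0 u w N - estimate xh0 u y N)"
proof (induction N)
  case 0
  then show ?case
    by (simp add: accrued_def)
next
  case (Suc N)
  have "accrued xh0 u w v x0 (Suc N)
      \<le> (\<Sum>t<N. stage (estimate xh0 u y t) (u t) (y t))
        + (- wnorm2 S (of_state M x0 u w N - estimate xh0 u y N)
           + (wnorm2 Q (of_state M x0 u w N) + wnorm2 R (u N) - \<gamma>\<^sup>2 * (norm (w N, v N))\<^sup>2))"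
    using Suc.IH by (simp add: accrued_def)
  also have "\<dots> \<le> (\<Sum>t<N. stage (estimate xh0 u y t) (u t) (y t))
        + (stage (estimate xh0 u y N) (u N) (y N)
           - wnorm2 S (of_state M x0 u w (Suc N) - estimate xh0 u y (Suc N)))"
    unfolding estimate_Suc of_state.simps
    by (intro add_left_mono cost_step_le y)
  finally show ?case
    by simp
qed

lemma of_state_cong:
  assumes "\<And>s. s < t \<Longrightarrow> w s = w' s"
  shows "of_state M x0 u w t = of_state M x0 u w' t"
  using assms by (induction t) auto

text \<open>The induction runs forwards in \<open>N\<close>, but the history is built backwards: the final state \<open>x\<close> is
  prescribed, the last step fixes the state before it, and this one is the prescribed state of the
  induction hypothesis.\<close>

lemma accrued_attained:
  "\<exists>w v x0. of_state M x0 u w N = x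
     \<and> (\<forall>t<N. y t = mC M *v of_state M x0 u w t + mD M *v v t)
     \<and> accrued xh0 u w v x0 N = (\<Sum>t<N. stage (estimate xh0 u y t) (u t) (y t))
         - wnorm2 S (x - estimate xh0 u y N)"
proof (induction N arbitrary: x)
  case 0
  then show ?case
    by (simp add: accrued_def)
next
  case (Suc N)
  obtain xN wN vN where step:
      "mA M *v xN + mB M *v u N + mG M *v wN = x" "y N = mC M *v xN + mD M *v vN"
      "- wnorm2 S (xN - estimate xh0 u y N)
         + (wnorm2 Q xN + wnorm2 R (u N) - \<gamma>\<^sup>2 * (norm (wN, vN))\<^sup>2)
       = stage (estimate xh0 u y N) (u N) (y N) - wnorm2 S (x - estimate xh0 u y (Suc N))"
    unfolding estimate_Suc by (rule cost_step_attained)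
  obtain w v x0 where history: "of_state M x0 u w N = xN"
      "\<forall>t<N. y t = mC M *v of_state M x0 u w t + mD M *v v t"
      "accrued xh0 u w v x0 N = (\<Sum>t<N. stage (estimate xh0 u y t) (u t) (y t))
         - wnorm2 S (xN - estimate xh0 u y N)"
    using Suc.IH by blast
  define w' where "w' = w(N := wN)"
  define v' where "v' = v(N := vN)"
  have states: "of_state M x0 u w' t = of_state M x0 u w t" if "t \<le> N" for t
    using that by (intro of_state_cong) (simp add: w'_def)
  have old: "accrued xh0 u w' v' x0 N = accrued xh0 u w v x0 N"
    by (simp add: accrued_def states) (simp add: w'_def v'_def)
  have new: "w' N = wN" "v' N = vN" "\<And>t. t < N \<Longrightarrow> v' t = v t"
    by (simp_all add: w'_def v'_def)
  have "accrued xh0 u w' v' x0 (Suc N) = accrued xh0 u w v x0 N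
      + (wnorm2 Q xN + wnorm2 R (u N) - \<gamma>\<^sup>2 * (norm (wN, vN))\<^sup>2)"
    unfolding old[symmetric] by (simp add: accrued_def states history(1) new)
  then have "accrued xh0 u w' v' x0 (Suc N)
      = (\<Sum>t<Suc N. stage (estimate xh0 u y t) (u t) (y t))
         - wnorm2 S (x - estimate xh0 u y (Suc N))"
    using step(3) history(3) by simp
  moreover have "of_state M x0 u w' (Suc N) = x"
    by (simp add: states history(1) new step(1))
  moreover have "\<forall>t<Suc N. y t = mC M *v of_state M x0 u w' t + mD M *v v' t"
    using history(1,2) step(2) by (auto simp: states new less_Suc_eq)
  ultimately show ?case
    by blast
qed

lemma of_cost_accrued:
  "S0 M = S \<Longrightarrow> of_cost Q R \<gamma> S0 xh0 N \<mu> M y w v x0 = accrued xh0 (of_input \<mu> y) w v x0 N"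
  by (simp add: of_cost_def accrued_def)

lemma of_cost_le:
  assumes "S0 M = S" and "of_consistent \<mu> M y w v x0"
  shows "of_cost Q R \<gamma> S0 xh0 N \<mu> M y w v x0
       \<le> (\<Sum>t<N. stage (estimate xh0 (of_input \<mu> y) y t) (of_input \<mu> y t) (y t))"
proof -
  have "y t = mC M *v of_state M x0 (of_input \<mu> y) w t + mD M *v v t" for t
    using assms(2) by (simp add: of_consistent_def)
  from accrued_le[OF this, of xh0 N] wnorm2_nonneg[OF pos_def_S]
  show ?thesis
    unfolding of_cost_accrued[of S0, OF assms(1)] by (smt (verit))
qed

lemma of_cost_attained:
  assumes "S0 M = S"
  obtains w v x0 where "of_consistent \<mu> M y w v x0"
    "of_cost Q R \<gamma> S0 xh0 N \<mu> M y w v x0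
       = (\<Sum>t<N. stage (estimate xh0 (of_input \<mu> y) y t) (of_input \<mu> y t) (y t))"
proof -
  let ?u = "of_input \<mu> y"
  obtain w v x0 where hist:
      "\<forall>t<N. y t = mC M *v of_state M x0 ?u w t + mD M *v v t"
      "accrued xh0 ?u w v x0 N = (\<Sum>t<N. stage (estimate xh0 ?u y t) (?u t) (y t))
         - wnorm2 S (estimate xh0 ?u y N - estimate xh0 ?u y N)"
    using accrued_attained by blast
  have "\<forall>t. \<exists>r. mD M *v r = y t - mC M *v of_state M x0 ?u w t"
    using output_onto unfolding surj_def by metis
  then obtain r where r: "\<And>t. mD M *v r t = y t - mC M *v of_state M x0 ?u w t"
    by metis
  \<comment> \<open>Consistency concerns all times: after the horizon \<open>v\<close> has to explain the remaining outputs.\<close>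
  define v' where "v' t = (if t < N then v t else r t)" for t
  have "of_consistent \<mu> M y w v' x0"
    using hist(1) by (simp add: of_consistent_def v'_def r)
  moreover have "accrued xh0 ?u w v' x0 N = accrued xh0 ?u w v x0 N"
    by (simp add: accrued_def v'_def)
  ultimately show thesis
    using that hist(2) by (simp add: of_cost_accrued[of S0, OF assms] wnorm2_def)
qed

text \<open>An output that agrees with the estimate is explained by the state \<open>xh\<close> without any residual, so the accrued
  cost at this state is \<open>|xh|\<^sub>Q\<^sup>2 + |u|\<^sub>R\<^sup>2\<close>; the stage cost is the maximum over all states.\<close>

lemma stage_response: "wnorm2 R u \<le> stage xh u (mC M *v xh)"
  using stage_eq_squares[of xh u "mC M *v xh" xh] wnorm2_nonneg[OF Q, of xh]
    wnorm2_nonneg[OF pos_def_X, of "xh - corrected xh (mC M *v xh)"]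
  by (simp add: wnorm2_def[of _ 0])

lemma neg_def_obs_Q_dd:
  assumes "pos_def (S - Q)"
  shows "neg_def (submatrix ixd ixd (obs_Q Q R \<gamma> M S X))"
proof -
  have Ti: "pos_def (matrix_inv (S - Q))"
    using assms by (rule pos_def_matrix_inv)
  have W: "pos_def ((1 / \<gamma>\<^sup>2) *\<^sub>R ric_W M)"
    using pos_def_ric_W gamma
    by (simp add: pos_def_def transpose_scalar scaleR_matrix_vector_assoc[symmetric])
  have "pos_def ((1 / \<gamma>\<^sup>2) *\<^sub>R ric_W M + mC M ** matrix_inv (S - Q) ** transpose (mC M))"
    (is "pos_def (?V + ?P)")
    unfolding pos_def_def
  proof (intro conjI allI impI)
    show "transpose (?V + ?P) = ?V + ?P"
      using W Ti by (simp add: transpose_plus matrix_transpose_mul matrix_mul_assoc pos_def_def)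
    fix y :: "real^'y"
    assume "y \<noteq> 0"
    then have "0 < y \<bullet> (?V *v y)"
      using W by (simp add: pos_def_def)
    moreover have "y \<bullet> (?P *v y) = wnorm2 (matrix_inv (S - Q)) (transpose (mC M) *v y)"
      using inner_transpose_right[of y "transpose (mC M)"]
      by (simp add: wnorm2_def matrix_vector_mul_assoc[symmetric])
    ultimately show "0 < y \<bullet> ((?V + ?P) *v y)"
      using wnorm2_nonneg[OF Ti]
      by (simp add: matrix_vector_mult_add_rdistrib inner_add_right add_pos_nonneg)
  qed
  then show ?thesis
    unfolding neg_def_def obs_Q_def submatrix_sym_block3 minus_minus by (rule pos_def_matrix_inv)
qed

lemma transpose_obs_Q: "transpose (obs_Q Q R \<gamma> M S X) = obs_Q Q R \<gamma> M S X"
  unfolding obs_Q_def output_block_eq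
  using transpose_matrix_inv[OF invertible_X transposes(2)]
  by (intro transpose_sym_block3)
    (simp_all add: transpose_diff transpose_uminus matrix_transpose_mul matrix_mul_assoc transposes
      transpose_noise_weight)

lemma placed_obs_Q_admissible:
  fixes i :: "'m::finite"
  assumes gap: "pos_def (S - Q)"
  defines "H \<equiv> place i (obs_Q Q R \<gamma> M S X)"
  shows "transpose H = H" "neg_def (submatrix ixd ixd H)" "pos_semidef (schur_dd H)"
    "pos_def (submatrix Inr Inr (schur_dd H))"
proof -
  show H: "transpose H = H"
    unfolding H_def transpose_place transpose_obs_Q ..
  show dd: "neg_def (submatrix ixd ixd H)"
    unfolding H_def submatrix_place_dd using gap by (rule neg_def_obs_Q_dd)
  have "\<exists>d. wnorm2 R u \<le> sigma3 H z u d" for z u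
  proof -
    obtain f where z: "z = stack_vec f"
      using stack_vec_surj by blast
    have "wnorm2 R u \<le> sigma3 H z u (mC M *v f i)"
      unfolding z H_def sigma3_place stage_def[symmetric] by (rule stage_response)
    then show ?thesis ..
  qed
  from schur_dd_definite[OF H dd R this]
  show "pos_semidef (schur_dd H)" "pos_def (submatrix Inr Inr (schur_dd H))"
    by blast+
qed

end

section \<open>Causal policies and the bank of observers\<close>

lemma obs_state_cong:
  assumes "\<And>s. s < t \<Longrightarrow> u s = u' s" "\<And>s. s < t \<Longrightarrow> y s = y' s"
  shows "obs_state A B G xh0 u y t = obs_state A B G xh0 u' y' t"
  using assms by (induction t) auto

lemma stacked_state:
  assumes A: "A = block_diag F" and B: "B = stack_mat Bf" and G: "G = stack_mat Gf"
    and z0: "z0 = stack_vec (\<lambda>i. xh0 i)"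
  shows "pr_state A B G z0 \<mu> d t
    = stack_vec (\<lambda>i. obs_state (F i) (Bf i) (Gf i) (xh0 i) (pr_input A B G z0 \<mu> d) d t)"
  by (induction t)
    (simp_all add: z0 A B G block_diag_vector stack_mat_vector stack_vec_add)

text \<open>Both closed loops obey the same recursion for the inputs once the principal state is known to be
  the bank of observers.\<close>

lemma pr_input_of_input:
  assumes impl: "implements \<zeta> \<mu> \<mu>h"
    and state: "\<And>t. pr_state A B G z0 \<mu>h d t = \<zeta> (pr_input A B G z0 \<mu>h d) d t"
  shows "pr_input A B G z0 \<mu>h d = of_input \<mu> d"
proof
  fix t
  show "pr_input A B G z0 \<mu>h d t = of_input \<mu> d t"
  proof (induction t rule: less_induct)
    case (less t)
    have "pr_state A B G z0 \<mu>h d = \<zeta> (pr_input A B G z0 \<mu>h d) d"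
      using state by (rule ext)
    then have "pr_input A B G z0 \<mu>h d t = \<mu> (map d [0..<t]) (map (pr_input A B G z0 \<mu>h d) [0..<t])"
      using impl unfolding implements_def by (subst pr_input.simps) metis
    also have "map (pr_input A B G z0 \<mu>h d) [0..<t] = map (of_input \<mu> d) [0..<t]"
      using less.IH by simp
    also have "\<mu> (map d [0..<t]) (map (of_input \<mu> d) [0..<t]) = of_input \<mu> d t"
      by (simp add: of_input.simps[of \<mu> d t])
    finally show ?case .
  qed
qed

text \<open>The output-feedback policy rebuilds \<open>z\<^sub>0, \<dots>, z\<^sub>t\<close> from the recorded inputs and outputs. Entries beyond
  the end of the two lists have unspecified values, which causality of \<open>\<zeta>\<close> makes harmless.\<close>

lemma causal_implementable:
  fixes \<zeta> :: "(nat \<Rightarrow> real^'u::finite) \<Rightarrow> (nat \<Rightarrow> real^'y::finite) \<Rightarrow> nat \<Rightarrow> real^'z::finite"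
    and \<mu>h :: "('z, 'u, 'y) pr_policy"
  assumes "\<And>u u' y y' t. (\<And>s. s < t \<Longrightarrow> u s = u' s) \<Longrightarrow> (\<And>s. s < t \<Longrightarrow> y s = y' s)
    \<Longrightarrow> \<zeta> u y t = \<zeta> u' y' t"
  shows "\<exists>\<mu>. implements \<zeta> \<mu> \<mu>h"
proof -
  define \<mu> :: "('y, 'u) of_policy" where
    "\<mu> ys us = \<mu>h (map (\<zeta> ((!) us) ((!) ys)) [0..<Suc (length ys)]) us ys" for ys us
  have "map (\<zeta> ((!) (map u [0..<t])) ((!) (map y [0..<t]))) [0..<Suc t]
      = map (\<zeta> u y) [0..<Suc t]" for u y t
    by (rule map_cong[OF refl], rule assms) auto
  then have "implements \<zeta> \<mu> \<mu>h"
    by (simp only: implements_def \<mu>_def length_map length_upt minus_nat.diff_0 simp_thms)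
  then show ?thesis
    by blast
qed

lemma implements_forget: "implements \<zeta> \<mu> (\<lambda>zs us ys. \<mu> ys us)"
  by (simp add: implements_def)

theorem theorem4:
  fixes Q :: "real^'x^'x" and R :: "real^'u^'u" and \<gamma> :: real and xhat0 :: "real^'x"
    and \<M> :: "('x::finite, 'u::finite, 'w::finite, 'y::finite, 'v::finite) model set"
    and mdl :: "'m::finite \<Rightarrow> ('x, 'u, 'w, 'y, 'v) model"
    and S X :: "('x, 'u, 'w, 'y, 'v) model \<Rightarrow> real^'x^'x"
    and L :: "('x, 'u, 'w, 'y, 'v) model \<Rightarrow> real^'y^'x"
    and Ahat :: "real^('m \<times> 'x)^('m \<times> 'x)"
    and Bhat :: "real^'u^('m \<times> 'x)"
    and Ghat :: "real^'y^('m \<times> 'x)"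
    and \<zeta> :: "(nat \<Rightarrow> real^'u) \<Rightarrow> (nat \<Rightarrow> real^'y) \<Rightarrow> nat \<Rightarrow> real^('m \<times> 'x)"
    and z0 :: "real^('m \<times> 'x)"
    and \<H> :: "(real^(('m \<times> 'x) + 'u + 'y)^(('m \<times> 'x) + 'u + 'y)) set"
  assumes "pos_def Q" and "pos_def R" and "\<gamma> > 0"
    and indexing: "bij_betw mdl UNIV \<M>"
    and rank: "\<And>M. M \<in> \<M> \<Longrightarrow> rank_assumptions Q M"
    and stabilizing: "\<And>M. M \<in> \<M> \<Longrightarrow> \<exists>S' X' L'. pd_fixed_point Q \<gamma> M S' X' L' \<and> stabilizing M S' X'"
    and fixed_point: "\<And>M. M \<in> \<M> \<Longrightarrow> minimal_fixed_point Q \<gamma> M (S M) (X M) (L M)"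
    and inverse_exists: "\<And>M. M \<in> \<M> \<Longrightarrow> invertible (S M - Q)"
    and Ahat: "Ahat = block_diag (\<lambda>i. obs_A (mdl i) (S (mdl i)) (X (mdl i)))"
    and Bhat: "Bhat = stack_mat (\<lambda>i. mB (mdl i))"
    and Ghat: "Ghat = stack_mat (\<lambda>i. L (mdl i))"
    and observers: "\<zeta> = (\<lambda>u y t. stack_vec (\<lambda>i.
          obs_state (obs_A (mdl i) (S (mdl i)) (X (mdl i))) (mB (mdl i)) (L (mdl i)) xhat0 u y t))"
    and z0: "z0 = stack_vec (\<lambda>i. xhat0)"
    and \<H>: "\<H> = range (\<lambda>i. place i (obs_Q Q R \<gamma> (mdl i) (S (mdl i)) (X (mdl i))))"
  shows "((\<forall>M\<in>\<M>. pos_def (S M - Q)) \<longrightarrow> pr_model_set \<H>)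
    \<and> of_value Q R \<gamma> \<M> S xhat0 = pr_value Ahat Bhat Ghat \<H> z0
    \<and> (\<forall>\<mu>h. (\<exists>\<mu>. implements \<zeta> \<mu> \<mu>h) \<and>
             (\<forall>\<mu>. implements \<zeta> \<mu> \<mu>h \<longrightarrow>
                  pr_sup Ahat Bhat Ghat \<H> z0 \<mu>h = of_sup Q R \<gamma> \<M> S xhat0 \<mu>))"
proof -
  have models: "\<M> = range mdl"
    using indexing by (simp add: bij_betw_def)
  have obs: "observer Q R \<gamma> (mdl i) (S (mdl i)) (X (mdl i)) (L (mdl i))" for i
  proof -
    have "mdl i \<in> \<M>"
      by (simp add: models)
    then show ?thesis
      using assms(1-3) rank[of "mdl i"] fixed_point[of "mdl i"] inverse_exists[of "mdl i"]
      by (simp add: observer_def rank_assumptions_def minimal_fixed_point_def)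
  qed
  have admissible: "pr_model_set \<H>" if gap: "\<forall>M\<in>\<M>. pos_def (S M - Q)"
    unfolding pr_model_set_def
  proof (intro conjI ballI)
    show "compact \<H>"
      unfolding \<H> by (intro finite_imp_compact) simp
    fix H
    assume "H \<in> \<H>"
    then obtain i where H: "H = place i (obs_Q Q R \<gamma> (mdl i) (S (mdl i)) (X (mdl i)))"
      unfolding \<H> by blast
    have "pos_def (S (mdl i) - Q)"
      using gap by (simp add: models)
    from observer.placed_obs_Q_admissible[OF obs this, of i, folded H]
    show "transpose H = H" "neg_def (submatrix ixd ixd H)" "pos_semidef (schur_dd H)"
      "pos_def (submatrix Inr Inr (schur_dd H))"
      by blast+
  qed
  have sups: "pr_sup Ahat Bhat Ghat \<H> z0 \<mu>h = of_sup Q R \<gamma> \<M> S xhat0 \<mu>"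
    if impl: "implements \<zeta> \<mu> \<mu>h" for \<mu> \<mu>h
  proof -
    \<comment> \<open>the common value of both problems for the model \<open>i\<close>, the output sequence \<open>d\<close> and the
      horizon \<open>N\<close>: the principal cost, and the worst output-feedback cost\<close>
    define J where "J i d N = (\<Sum>t<N. observer.stage Q R \<gamma> (mdl i) (S (mdl i)) (X (mdl i))
        (obs_state (obs_A (mdl i) (S (mdl i)) (X (mdl i))) (mB (mdl i)) (L (mdl i)) xhat0
          (of_input \<mu> d) d t) (of_input \<mu> d t) (d t))" for i d N
    have state: "pr_state Ahat Bhat Ghat z0 \<mu>h d t = \<zeta> (pr_input Ahat Bhat Ghat z0 \<mu>h d) d t" for d t
      unfolding observers by (rule stacked_state[OF Ahat Bhat Ghat z0])
    have input: "pr_input Ahat Bhat Ghat z0 \<mu>h d = of_input \<mu> d" for d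
      by (rule pr_input_of_input[OF impl state])
    have cost: "pr_cost Ahat Bhat Ghat N \<mu>h z0
        (place i (obs_Q Q R \<gamma> (mdl i) (S (mdl i)) (X (mdl i)))) d = J i d N" for i d N
      unfolding pr_cost_def state input observers sigma3_place J_def observer.stage_def[OF obs] ..
    show ?thesis
    proof (rule antisym)
      show "pr_sup Ahat Bhat Ghat \<H> z0 \<mu>h \<le> of_sup Q R \<gamma> \<M> S xhat0 \<mu>"
        unfolding pr_sup_def
      proof (rule SUP_least, clarify)
        fix H d N
        assume "H \<in> \<H>"
        then obtain i where H: "H = place i (obs_Q Q R \<gamma> (mdl i) (S (mdl i)) (X (mdl i)))"
          unfolding \<H> by blast
        obtain w v x0 where wvx: "of_consistent \<mu> (mdl i) d w v x0"
            "of_cost Q R \<gamma> S xhat0 N \<mu> (mdl i) d w v x0 = J i d N"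
          unfolding J_def by (rule observer.of_cost_attained[OF obs, of S]) simp
        show "ereal (pr_cost Ahat Bhat Ghat N \<mu>h z0 H d) \<le> of_sup Q R \<gamma> \<M> S xhat0 \<mu>"
          unfolding of_sup_def H cost wvx(2)[symmetric]
          by (rule SUP_upper2[of "(d, mdl i, N, w, v, x0)"]) (simp_all add: wvx(1) models)
      qed
      show "of_sup Q R \<gamma> \<M> S xhat0 \<mu> \<le> pr_sup Ahat Bhat Ghat \<H> z0 \<mu>h"
        unfolding of_sup_def
      proof (rule SUP_least, clarify)
        fix y M N w v x0
        assume "M \<in> \<M>" and cons: "of_consistent \<mu> M y w v x0"
        then obtain i where M: "M = mdl i"
          unfolding models by blast
        have "of_cost Q R \<gamma> S xhat0 N \<mu> M y w v x0 \<le> J i y N"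
          unfolding J_def M by (rule observer.of_cost_le[OF obs]) (use cons M in auto)
        also have "ereal (J i y N) \<le> pr_sup Ahat Bhat Ghat \<H> z0 \<mu>h"
          unfolding pr_sup_def cost[symmetric]
          by (rule SUP_upper2[of "(place i (obs_Q Q R \<gamma> (mdl i) (S (mdl i)) (X (mdl i))), y, N)"])
            (simp_all add: \<H>)
        finally show "ereal (of_cost Q R \<gamma> S xhat0 N \<mu> M y w v x0)
            \<le> pr_sup Ahat Bhat Ghat \<H> z0 \<mu>h"
          by simp
      qed
    qed
  qed
  have feasible: "\<exists>\<mu>. implements \<zeta> \<mu> \<mu>h" for \<mu>h
    unfolding observers by (intro causal_implementable arg_cong[of _ _ stack_vec] ext obs_state_cong)
  have "of_value Q R \<gamma> \<M> S xhat0 = pr_value Ahat Bhat Ghat \<H> z0"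
  proof (rule antisym)
    show "of_value Q R \<gamma> \<M> S xhat0 \<le> pr_value Ahat Bhat Ghat \<H> z0"
      unfolding of_value_def pr_value_def
      by (rule INF_mono) (metis feasible sups UNIV_I order_refl)
    show "pr_value Ahat Bhat Ghat \<H> z0 \<le> of_value Q R \<gamma> \<M> S xhat0"
      unfolding of_value_def pr_value_def
      by (rule INF_mono) (metis implements_forget sups UNIV_I order_refl)
  qed
  with admissible sups feasible show ?thesis
    by blast
qed

end
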